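(* Let ${}^*\mathcal{M}=\langle {}^*X,\in,=\rangle$ be a nonstandard model of a superstructure $\langle X,\in,=\rangle$ whose set of atoms contains $\mathbb{N}$, and let $\lambda\in{}^*\mathbb{N}\setminus\mathbb{N}$ be any infinite natural number. Put $$T_\lambda^H=\{i\in{}^*\mathbb{N}\mid 0\le i\le\lambda\},\qquad \mathcal{A}_\lambda^H=\{\lambda+1\},\qquad A_\lambda^H=\{(\lambda+1,i)\mid i\in{}^*\mathbb{N},\ 0\le i\le\lambda\},$$ $$S_\lambda^H=\{(i+1,i,\lambda+1)\mid i\in{}^*\mathbb{N},\ 0\le i\le\lambda-1\}\cup\{(0,\lambda,\lambda+1)\},$$ $$D_\lambda^H=\{(1,0),(1,\lambda+1),(2,1),(2,\lambda+1)\},\qquad {}^*N^H=\{1,2\},$$ and let $\mathcal{D}_\lambda^H$ be the structure with domain $T_\lambda^H\cup\mathcal{A}_\lambda^H$ in which $T,A,S,D,N$ are interpreted by $T_\lambda^H,A_\lambda^H,S_\lambda^H,D_\lambda^H,{}^*N^H$ respectively. Then $\mathcal{D}_\lambda^H$ is an infinite hyperfinite structure; each of the sets $T_\lambda^H\cup\mathcal{A}_\lambda^H$, $T_\lambda^H$, $\mathcal{A}_\lambda^H$, ${}^*N^H$, $S_\lambda^H$, $A_\lambda^H$, $D_\lambda^H$ is an internal member of ${}^*X$; and $\mathcal{D}_\lambda^H$ is a model for the scheme $TAS_1$ and for the scheme $TAS_2$.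
   Context: Nonstandard setting: ${}^*\mathcal{M}$ is a Robinson-styled nonstandard model, i.e. the map $Y\mapsto{}^*Y$ satisfies the transfer principle for all bounded set-theoretic first-order statements holding in $\langle X,\in,=\rangle$, and ${}^*\mathbb{N}$ properly extends $\mathbb{N}$, where each ${}^*p$ is identified with $p\in\mathbb{N}$ ($0\in\mathbb{N}$). Elements of ${}^*\mathbb{N}\setminus\mathbb{N}$ are called infinite natural numbers. Internal objects are the members of the sets ${}^*Y$ with $Y\in X$. A set is hyperfinite if it is empty or there is an internal bijection onto it from $\{i\in{}^*\mathbb{N}\mid 1\le i\le n\}$ for some $n\in{}^*\mathbb{N}$, $n\ge1$; an infinite hyperfinite structure is one whose domain is hyperfinite and infinite. The schemes are sets of axioms in first-order logic with equality, with unary predicates $T,N$, binary predicates $A,D$ and a ternary predicate $S$. $A(y,x)$ holds iff $(y,x)$ is in the relation interpreting $A$, and $S(z,x,y)$ holds iff $(z,x,y)$ is in the relation interpreting $S$, etc. All quantifiers range over the domain. $N$ is a defined predicate: $N(z)$ abbreviates $\exists x\exists y[S(z,x,y)\land D(z,x)\land D(z,y)]$. In a model, the relation listed for $N$ must coincide with this defined predicate. $TAS_1$ consists of the axioms: E1: $\exists x[T(x)]$. E2: $\forall x[T(x)\to\exists!\,y[A(y,x)]]$. E3: $\forall x\forall y[A(y,x)\to\exists!\,z[S(z,x,y)]]$. R1: $\forall x\forall y[A(y,x)\to[T(x)\land\neg A(x,y)]]$. R2: $\forall x\forall y\forall z[S(z,x,y)\to[T(z)\land[A(x,y)\lor A(y,x)]\land\neg[S(x,z,y)\lor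 S(y,x,z)]]]$. $TAS_2$ consists of E1, E2, E3, R1, R2 together with: E4: $\exists x[N(x)]$. E5: $\forall x[N(x)\to\exists y[N(y)\land y\neq x]]$. *)

theory Defs
  imports Main
begin

section \<open>Set-theoretic structures with atoms and superstructures\<close>

text \<open>
  A structure \<open>\<langle>X, \<in>, =\<rangle>\<close> is given by a carrier, its set of atoms and a membership relation.
  Superstructures are described intrinsically (up to isomorphism) over an arbitrary type,
  because plain HOL cannot construct the union of all finite iterates of the power set of an
  infinite set as one type; over a type of ZFC sets such structures exist.
\<close>

record 'a ustruct =
  univ :: "'a set"
  atoms :: "'a set"
  elem :: "'a \<Rightarrow> 'a \<Rightarrow> bool"

definition members :: "'a ustruct \<Rightarrow> 'a \<Rightarrow> 'a set" where
  "members M x = {z \<in> univ M. elem M z x}"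

definition set_structure :: "'a ustruct \<Rightarrow> bool" where
  "set_structure M \<longleftrightarrow>
     atoms M \<subseteq> univ M \<and>
     (\<forall>a \<in> atoms M. members M a = {}) \<and>
     (\<forall>x \<in> univ M - atoms M. \<forall>y \<in> univ M - atoms M. members M x = members M y \<longrightarrow> x = y)"

primrec level :: "'a ustruct \<Rightarrow> nat \<Rightarrow> 'a set" where
  "level M 0 = atoms M"
| "level M (Suc n) = level M n \<union> {x \<in> univ M - atoms M. members M x \<subseteq> level M n}"

text \<open>
  \<open>X\<^sub>0\<close> is the set of atoms, \<open>X\<^sub>n\<^sub>+\<^sub>1\<close> is the union of \<open>X\<^sub>n\<close> and its \<^emph>\<open>full\<close> power set,
  and \<open>X\<close> is the union of all \<open>X\<^sub>n\<close>.
\<close>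

definition superstructure :: "'a ustruct \<Rightarrow> bool" where
  "superstructure M \<longleftrightarrow>
     set_structure M \<and>
     (\<forall>n. \<forall>S. S \<subseteq> level M n \<longrightarrow> (\<exists>x \<in> univ M - atoms M. members M x = S)) \<and>
     univ M = (\<Union>n. level M n)"

text \<open>The object of the structure that is the set with exactly the members \<open>S\<close>.\<close>

definition coll :: "'a ustruct \<Rightarrow> 'a set \<Rightarrow> 'a" where
  "coll M S = (THE x. x \<in> univ M - atoms M \<and> members M x = S)"

text \<open>Kuratowski pairs; triples are \<open>((a, b), c)\<close>.\<close>

definition opair :: "'a ustruct \<Rightarrow> 'a \<Rightarrow> 'a \<Rightarrow> 'a" where
  "opair M a b = coll M {coll M {a}, coll M {a, b}}"

definition otriple :: "'a ustruct \<Rightarrow> 'a \<Rightarrow> 'a \<Rightarrow> 'a \<Rightarrow> 'a" where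
  "otriple M a b c = opair M (opair M a b) c"


section \<open>Bounded set-theoretic first-order sentences\<close>

datatype 'a trm = Var nat | Cst 'a

datatype 'a bfm =
    BMem "'a trm" "'a trm"
  | BEq "'a trm" "'a trm"
  | BNot "'a bfm"
  | BAnd "'a bfm" "'a bfm"
  | BOr "'a bfm" "'a bfm"
  | BImp "'a bfm" "'a bfm"
  | BAll nat "'a trm" "'a bfm" \<comment> \<open>\<open>\<forall>v \<in> t. \<phi>\<close>\<close>
  | BEx nat "'a trm" "'a bfm"  \<comment> \<open>\<open>\<exists>v \<in> t. \<phi>\<close>\<close>

primrec tfv :: "'a trm \<Rightarrow> nat set" where
  "tfv (Var n) = {n}"
| "tfv (Cst c) = {}"

primrec bfv :: "'a bfm \<Rightarrow> nat set" where
  "bfv (BMem s t) = tfv s \<union> tfv t"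
| "bfv (BEq s t) = tfv s \<union> tfv t"
| "bfv (BNot \<phi>) = bfv \<phi>"
| "bfv (BAnd \<phi> \<psi>) = bfv \<phi> \<union> bfv \<psi>"
| "bfv (BOr \<phi> \<psi>) = bfv \<phi> \<union> bfv \<psi>"
| "bfv (BImp \<phi> \<psi>) = bfv \<phi> \<union> bfv \<psi>"
| "bfv (BAll v t \<phi>) = tfv t \<union> (bfv \<phi> - {v})"
| "bfv (BEx v t \<phi>) = tfv t \<union> (bfv \<phi> - {v})"

primrec tval :: "(nat \<Rightarrow> 'a) \<Rightarrow> 'a trm \<Rightarrow> 'a" where
  "tval e (Var n) = e n"
| "tval e (Cst c) = c"

primrec bsat :: "'a ustruct \<Rightarrow> (nat \<Rightarrow> 'a) \<Rightarrow> 'a bfm \<Rightarrow> bool" where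
  "bsat M e (BMem s t) = elem M (tval e s) (tval e t)"
| "bsat M e (BEq s t) = (tval e s = tval e t)"
| "bsat M e (BNot \<phi>) = (\<not> bsat M e \<phi>)"
| "bsat M e (BAnd \<phi> \<psi>) = (bsat M e \<phi> \<and> bsat M e \<psi>)"
| "bsat M e (BOr \<phi> \<psi>) = (bsat M e \<phi> \<or> bsat M e \<psi>)"
| "bsat M e (BImp \<phi> \<psi>) = (bsat M e \<phi> \<longrightarrow> bsat M e \<psi>)"
| "bsat M e (BAll v t \<phi>) = (\<forall>a \<in> members M (tval e t). bsat M (e(v := a)) \<phi>)"
| "bsat M e (BEx v t \<phi>) = (\<exists>a \<in> members M (tval e t). bsat M (e(v := a)) \<phi>)"

definition bsentence :: "'a ustruct \<Rightarrow> 'a bfm \<Rightarrow> bool" where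
  "bsentence M \<phi> \<longleftrightarrow> bfv \<phi> = {} \<and> set_bfm \<phi> \<subseteq> univ M"

definition btrue :: "'a ustruct \<Rightarrow> 'a bfm \<Rightarrow> bool" where
  "btrue M \<phi> \<longleftrightarrow> (\<forall>e. bsat M e \<phi>)"


section \<open>Nonstandard models\<close>

text \<open>
  \<open>base\<close> is \<open>\<langle>X, \<in>, =\<rangle>\<close>, \<open>natom\<close> names the natural numbers among its atoms,
  \<open>enl\<close> is \<open>\<langle>*X, \<in>, =\<rangle>\<close> and \<open>star\<close> is the map \<open>Y \<mapsto> *Y\<close>.
\<close>

record ('a, 'b) nsm =
  base :: "'a ustruct"
  natom :: "nat \<Rightarrow> 'a"
  enl :: "'b ustruct"
  star :: "'a \<Rightarrow> 'b"

text \<open>The sentence \<open>*\<phi>\<close> replaces every constant \<open>c\<close> of \<open>\<phi>\<close> by \<open>*c\<close>.\<close>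

definition transfer_principle :: "('a, 'b) nsm \<Rightarrow> bool" where
  "transfer_principle E \<longleftrightarrow>
     (\<forall>\<phi>. bsentence (base E) \<phi> \<longrightarrow> btrue (base E) \<phi> \<longrightarrow> btrue (enl E) (map_bfm (star E) \<phi>))"

definition hnat :: "('a, 'b) nsm \<Rightarrow> 'b set" where
  "hnat E = members (enl E) (star E (coll (base E) (range (natom E))))"

text \<open>The natural number \<open>p\<close> as an element of \<open>*\<nat>\<close> (the identification of \<open>*p\<close> with \<open>p\<close>).\<close>

definition hstd :: "('a, 'b) nsm \<Rightarrow> nat \<Rightarrow> 'b" where
  "hstd E p = star E (natom E p)"

definition nonstandard_model :: "('a, 'b) nsm \<Rightarrow> bool" where
  "nonstandard_model E \<longleftrightarrow>
     superstructure (base E) \<and>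
     inj (natom E) \<and> range (natom E) \<subseteq> atoms (base E) \<and>
     set_structure (enl E) \<and>
     star E ` univ (base E) \<subseteq> univ (enl E) \<and>
     atoms (enl E) = members (enl E) (star E (coll (base E) (atoms (base E)))) \<and>
     transfer_principle E \<and>
     range (hstd E) \<subset> hnat E"

text \<open>Order and arithmetic on \<open>*\<nat>\<close> are the star images of those on \<open>\<nat>\<close>.\<close>

definition hle :: "('a, 'b) nsm \<Rightarrow> 'b \<Rightarrow> 'b \<Rightarrow> bool" where
  "hle E a b \<longleftrightarrow>
     opair (enl E) a b \<in> members (enl E)
       (star E (coll (base E) {opair (base E) (natom E m) (natom E n) | m n. m \<le> n}))"

definition hop :: "('a, 'b) nsm \<Rightarrow> (nat \<Rightarrow> nat \<Rightarrow> nat) \<Rightarrow> 'b \<Rightarrow> 'b \<Rightarrow> 'b" where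
  "hop E f a b =
     (THE c. c \<in> hnat E \<and> otriple (enl E) a b c \<in> members (enl E)
       (star E (coll (base E)
          {otriple (base E) (natom E m) (natom E n) (natom E (f m n)) | m n. True})))"

definition hplus :: "('a, 'b) nsm \<Rightarrow> 'b \<Rightarrow> 'b \<Rightarrow> 'b" where
  "hplus E = hop E (+)"

text \<open>Truncated subtraction; it is only applied to \<open>\<lambda> - 1\<close> with \<open>\<lambda> \<ge> 1\<close>.\<close>

definition hminus :: "('a, 'b) nsm \<Rightarrow> 'b \<Rightarrow> 'b \<Rightarrow> 'b" where
  "hminus E = hop E (-)"

definition hinterval :: "('a, 'b) nsm \<Rightarrow> 'b \<Rightarrow> 'b \<Rightarrow> 'b set" where
  "hinterval E a b = {i \<in> hnat E. hle E a i \<and> hle E i b}"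

definition internal :: "('a, 'b) nsm \<Rightarrow> 'b \<Rightarrow> bool" where
  "internal E y \<longleftrightarrow> y \<in> univ (enl E) \<and> (\<exists>Y \<in> univ (base E). elem (enl E) y (star E Y))"

definition internal_set :: "('a, 'b) nsm \<Rightarrow> 'b set \<Rightarrow> bool" where
  "internal_set E S \<longleftrightarrow>
     (\<exists>s \<in> univ (enl E) - atoms (enl E). internal E s \<and> members (enl E) s = S)"

text \<open>
  Relations are written with HOL tuples; these give the corresponding sets of tuples of \<open>*X\<close>.
\<close>

definition internal_rel2 :: "('a, 'b) nsm \<Rightarrow> ('b \<times> 'b) set \<Rightarrow> bool" where
  "internal_rel2 E R \<longleftrightarrow> internal_set E {opair (enl E) a b | a b. (a, b) \<in> R}"

definition internal_rel3 :: "('a, 'b) nsm \<Rightarrow> ('b \<times> 'b \<times> 'b) set \<Rightarrow> bool" where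
  "internal_rel3 E R \<longleftrightarrow> internal_set E {otriple (enl E) a b c | a b c. (a, b, c) \<in> R}"

definition hyperfinite :: "('a, 'b) nsm \<Rightarrow> 'b set \<Rightarrow> bool" where
  "hyperfinite E B \<longleftrightarrow>
     B = {} \<or>
     (\<exists>n \<in> hnat E. hle E (hstd E 1) n \<and>
        (\<exists>F. bij_betw F (hinterval E (hstd E 1) n) B \<and>
             internal_rel2 E {(i, F i) | i. i \<in> hinterval E (hstd E 1) n}))"


section \<open>The axiom schemes\<close>

datatype fm =
    PT nat | PN nat | PA nat nat | PD nat nat | PS nat nat nat | PEq nat nat
  | FNot fm | FAnd fm fm | FOr fm fm | FImp fm fm | FIff fm fm
  | FAll nat fm | FEx nat fm | FEx1 nat fm

record 'b tas_struct =
  domain :: "'b set"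
  relT :: "'b set"
  relA :: "('b \<times> 'b) set"
  relS :: "('b \<times> 'b \<times> 'b) set"
  relD :: "('b \<times> 'b) set"
  relN :: "'b set"

definition tas_structure :: "'b tas_struct \<Rightarrow> bool" where
  "tas_structure M \<longleftrightarrow>
     domain M \<noteq> {} \<and> relT M \<subseteq> domain M \<and> relN M \<subseteq> domain M \<and>
     relA M \<subseteq> domain M \<times> domain M \<and> relD M \<subseteq> domain M \<times> domain M \<and>
     relS M \<subseteq> domain M \<times> domain M \<times> domain M"

primrec fsat :: "'b tas_struct \<Rightarrow> (nat \<Rightarrow> 'b) \<Rightarrow> fm \<Rightarrow> bool" where
  "fsat M e (PT x) = (e x \<in> relT M)"
| "fsat M e (PN x) = (e x \<in> relN M)"
| "fsat M e (PA x y) = ((e x, e y) \<in> relA M)"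
| "fsat M e (PD x y) = ((e x, e y) \<in> relD M)"
| "fsat M e (PS x y z) = ((e x, e y, e z) \<in> relS M)"
| "fsat M e (PEq x y) = (e x = e y)"
| "fsat M e (FNot \<phi>) = (\<not> fsat M e \<phi>)"
| "fsat M e (FAnd \<phi> \<psi>) = (fsat M e \<phi> \<and> fsat M e \<psi>)"
| "fsat M e (FOr \<phi> \<psi>) = (fsat M e \<phi> \<or> fsat M e \<psi>)"
| "fsat M e (FImp \<phi> \<psi>) = (fsat M e \<phi> \<longrightarrow> fsat M e \<psi>)"
| "fsat M e (FIff \<phi> \<psi>) = (fsat M e \<phi> \<longleftrightarrow> fsat M e \<psi>)"
| "fsat M e (FAll v \<phi>) = (\<forall>a \<in> domain M. fsat M (e(v := a)) \<phi>)"
| "fsat M e (FEx v \<phi>) = (\<exists>a \<in> domain M. fsat M (e(v := a)) \<phi>)"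
| "fsat M e (FEx1 v \<phi>) = (\<exists>!a. a \<in> domain M \<and> fsat M (e(v := a)) \<phi>)"

text \<open>In the axioms the variables \<open>x\<close>, \<open>y\<close>, \<open>z\<close> are numbered 0, 1, 2.\<close>

definition ax_E1 :: fm where
  "ax_E1 = FEx 0 (PT 0)"

definition ax_E2 :: fm where
  "ax_E2 = FAll 0 (FImp (PT 0) (FEx1 1 (PA 1 0)))"

definition ax_E3 :: fm where
  "ax_E3 = FAll 0 (FAll 1 (FImp (PA 1 0) (FEx1 2 (PS 2 0 1))))"

definition ax_R1 :: fm where
  "ax_R1 = FAll 0 (FAll 1 (FImp (PA 1 0) (FAnd (PT 0) (FNot (PA 0 1)))))"

definition ax_R2 :: fm where
  "ax_R2 = FAll 0 (FAll 1 (FAll 2 (FImp (PS 2 0 1)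
     (FAnd (PT 2) (FAnd (FOr (PA 0 1) (PA 1 0)) (FNot (FOr (PS 0 2 1) (PS 1 0 2))))))))"

definition ax_E4 :: fm where
  "ax_E4 = FEx 0 (PN 0)"

definition ax_E5 :: fm where
  "ax_E5 = FAll 0 (FImp (PN 0) (FEx 1 (FAnd (PN 1) (FNot (PEq 1 0)))))"

definition TAS1 :: "fm set" where
  "TAS1 = {ax_E1, ax_E2, ax_E3, ax_R1, ax_R2}"

definition TAS2 :: "fm set" where
  "TAS2 = TAS1 \<union> {ax_E4, ax_E5}"

text \<open>
  \<open>N\<close> is a defined predicate, so every model has to satisfy its defining equivalence.
\<close>

definition def_N :: fm where
  "def_N = FAll 2 (FIff (PN 2) (FEx 0 (FEx 1 (FAnd (PS 2 0 1) (FAnd (PD 2 0) (PD 2 1))))))"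

definition tas_model :: "'b tas_struct \<Rightarrow> fm set \<Rightarrow> bool" where
  "tas_model M \<Gamma> \<longleftrightarrow>
     tas_structure M \<and> (\<forall>\<phi> \<in> insert def_N \<Gamma>. \<forall>e. range e \<subseteq> domain M \<longrightarrow> fsat M e \<phi>)"


section \<open>The hyperfinite structure\<close>

definition TH :: "('a, 'b) nsm \<Rightarrow> 'b \<Rightarrow> 'b set" where
  "TH E l = hinterval E (hstd E 0) l"

definition agentH :: "('a, 'b) nsm \<Rightarrow> 'b \<Rightarrow> 'b set" where
  "agentH E l = {hplus E l (hstd E 1)}"

definition AH :: "('a, 'b) nsm \<Rightarrow> 'b \<Rightarrow> ('b \<times> 'b) set" where
  "AH E l = {(hplus E l (hstd E 1), i) | i. i \<in> hinterval E (hstd E 0) l}"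

definition SH :: "('a, 'b) nsm \<Rightarrow> 'b \<Rightarrow> ('b \<times> 'b \<times> 'b) set" where
  "SH E l =
     {(hplus E i (hstd E 1), i, hplus E l (hstd E 1)) | i.
        i \<in> hinterval E (hstd E 0) (hminus E l (hstd E 1))}
     \<union> {(hstd E 0, l, hplus E l (hstd E 1))}"

definition DH :: "('a, 'b) nsm \<Rightarrow> 'b \<Rightarrow> ('b \<times> 'b) set" where
  "DH E l =
     {(hstd E 1, hstd E 0), (hstd E 1, hplus E l (hstd E 1)),
      (hstd E 2, hstd E 1), (hstd E 2, hplus E l (hstd E 1))}"

definition NH :: "('a, 'b) nsm \<Rightarrow> 'b set" where
  "NH E = {hstd E 1, hstd E 2}"

definition structH :: "('a, 'b) nsm \<Rightarrow> 'b \<Rightarrow> 'b tas_struct" where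
  "structH E l =
     \<lparr>domain = TH E l \<union> agentH E l, relT = TH E l, relA = AH E l, relS = SH E l,
      relD = DH E l, relN = NH E\<rparr>"

end

(*
  Every set in the statement is the value at the infinite l of a family of sets that is defined
  over the natural numbers by a bounded formula. One transferred sentence collects the arithmetic
  of successor, predecessor and order on *N; from it the axioms and the bijection i -> i - 1 from
  [1, l + 2] onto the domain are checked as for a finite l. Internality is the internal definition
  principle: "for every n there is an element of the power set of Y with exactly the members y
  satisfying phi(n, y)" holds in the superstructure, and its transfer is instantiated at l.
*)

theory Submission
  imports Defs
begin

section \<open>Pairs in set structures\<close>

text \<open>\<open>coll\<close> is a definite description, and the nonstandard universe need not be
  closed under arbitrary collections, so \<open>opair\<close> over \<open>enl E\<close> denotes a
  pair only where a pair is known to exist. The relation \<open>is_pair\<close> takes its place: it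
  asserts existence, has the same bounded formula in both structures, and determines
  \<open>opair\<close> by extensionality. Existence over the hypernaturals is itself obtained by
  transfer, from the products N x N and (N x N) x N. Likewise \<open>hop\<close> becomes usable only
  after existence and uniqueness of values have been transferred. That l is infinite enters in three
  ways: l is not 0, so l - 1 is a true predecessor; l is not 1, so the cyclic successor on [0, l]
  encoded by \<open>SH\<close> has no two-cycle; and every standard number lies below l, which puts
  0, 1, 2 into \<open>TH\<close> and makes the domain infinite.\<close>

definition is_pair :: "'a ustruct \<Rightarrow> 'a \<Rightarrow> 'a \<Rightarrow> 'a \<Rightarrow> bool" where
  "is_pair M p a b \<longleftrightarrow> p \<in> univ M - atoms M \<and>
     (\<exists>u \<in> univ M - atoms M. \<exists>v \<in> univ M - atoms M.
        members M u = {a} \<and> members M v = {a, b} \<and> members M p = {u, v})"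

lemma members_subset_univ: "members M x \<subseteq> univ M"
  by (auto simp: members_def)

lemma coll_eqI:
  assumes "set_structure M" "x \<in> univ M - atoms M" "members M x = S"
  shows "coll M S = x"
  unfolding coll_def using assms by (intro the_equality) (auto simp: set_structure_def)

text \<open>Extensionality on non-atoms identifies the three nested descriptions in
  \<open>opair\<close> with the witnesses of \<open>is_pair\<close>.\<close>

lemma opair_eqI:
  assumes "set_structure M" "is_pair M p a b"
  shows "opair M a b = p"
proof -
  obtain u v where uv: "u \<in> univ M - atoms M" "v \<in> univ M - atoms M"
      "members M u = {a}" "members M v = {a, b}" "members M p = {u, v}"
    and p: "p \<in> univ M - atoms M"
    using assms(2) unfolding is_pair_def by blast
  have "coll M {a} = u" "coll M {a, b} = v" "coll M {u, v} = p"
    using coll_eqI[OF assms(1)] uv p by auto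
  then show ?thesis by (simp add: opair_def)
qed

lemma is_pair_inject:
  assumes "is_pair M p a b" "is_pair M p c d"
  shows "a = c \<and> b = d"
proof -
  obtain u v where 1: "members M u = {a}" "members M v = {a, b}" "members M p = {u, v}"
    using assms(1) unfolding is_pair_def by blast
  obtain u' v' where 2: "members M u' = {c}" "members M v' = {c, d}" "members M p = {u', v'}"
    using assms(2) unfolding is_pair_def by blast
  \<comment> \<open>In the crossed case \<open>{a} = {c, d}\<close> and \<open>{a, b} = {c}\<close>,
    so all four components coincide.\<close>
  have "u = u' \<and> v = v' \<or> u = v' \<and> v = u'"
    using 1(3) 2(3) by (metis doubleton_eq_iff)
  then show ?thesis
    using 1 2 by (metis doubleton_eq_iff insert_absorb2)
qed

section \<open>Closure of a superstructure under pairs, products and power sets\<close>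

lemma level_mono: "m \<le> n \<Longrightarrow> level M m \<subseteq> level M n"
  by (rule lift_Suc_mono_le) auto

lemma atom_members: "set_structure M \<Longrightarrow> a \<in> atoms M \<Longrightarrow> members M a = {}"
  by (simp add: set_structure_def)

text \<open>Transitivity of the levels, starting from the emptiness of atoms. It puts all members of
  one object into a single level, as fullness requires.\<close>

lemma members_subset_level:
  assumes "set_structure M"
  shows "x \<in> level M n \<Longrightarrow> members M x \<subseteq> level M n"
proof (induction n)
  case 0
  then show ?case using assms by (simp add: atom_members)
next
  case (Suc n)
  then show ?case by auto
qed

lemma ex_level:
  assumes "superstructure M" "a \<in> univ M" "b \<in> univ M"
  obtains n where "a \<in> level M n" "b \<in> level M n"
proof -
  obtain m k where "a \<in> level M m" "b \<in> level M k"
    using assms by (auto simp: superstructure_def)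
  then have "a \<in> level M (max m k)" "b \<in> level M (max m k)"
    using level_mono[of m "max m k" M] level_mono[of k "max m k" M] by auto
  then show thesis by (rule that)
qed

text \<open>Fullness speaks only about subsets of a single level. Recording that the result lies one
  level higher lets the construction be iterated for pairs and products.\<close>

lemma coll_superstructure:
  assumes "superstructure M" "S \<subseteq> level M n"
  shows "coll M S \<in> univ M - atoms M" "members M (coll M S) = S" "coll M S \<in> level M (Suc n)"
proof -
  obtain x where x: "x \<in> univ M - atoms M" "members M x = S"
    using assms unfolding superstructure_def by meson
  then have "coll M S = x"
    using assms(1) by (intro coll_eqI) (auto simp: superstructure_def)
  with x show "coll M S \<in> univ M - atoms M" "members M (coll M S) = S" by auto
  then show "coll M S \<in> level M (Suc n)" using assms(2) by auto
qed

lemma opair_superstructure: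
  assumes "superstructure M" "a \<in> level M n" "b \<in> level M n"
  shows "is_pair M (opair M a b) a b" "opair M a b \<in> level M (Suc (Suc n))"
proof -
  note c = coll_superstructure[OF assms(1)]
  have "{a} \<subseteq> level M n" "{a, b} \<subseteq> level M n" using assms by auto
  note ab = c[OF this(1)] c[OF this(2)]
  then have "{coll M {a}, coll M {a, b}} \<subseteq> level M (Suc n)" by blast
  note p = c[OF this]
  show "is_pair M (opair M a b) a b"
    unfolding is_pair_def opair_def using ab p by blast
  show "opair M a b \<in> level M (Suc (Suc n))"
    unfolding opair_def by (rule p)
qed

lemma is_pair_superstructure:
  assumes "superstructure M" "a \<in> univ M" "b \<in> univ M"
  shows "is_pair M (opair M a b) a b"
  using assms ex_level opair_superstructure(1) by metis

definition prod_obj :: "'a ustruct \<Rightarrow> 'a \<Rightarrow> 'a \<Rightarrow> 'a" where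
  "prod_obj M X Y = coll M {opair M a b | a b. a \<in> members M X \<and> b \<in> members M Y}"

lemma prod_obj_superstructure:
  assumes "superstructure M" "X \<in> univ M" "Y \<in> univ M"
  shows "prod_obj M X Y \<in> univ M - atoms M"
    "members M (prod_obj M X Y) = {opair M a b | a b. a \<in> members M X \<and> b \<in> members M Y}"
proof -
  obtain n where "X \<in> level M n" "Y \<in> level M n" using ex_level assms by metis
  then have "members M X \<subseteq> level M n" "members M Y \<subseteq> level M n"
    using assms(1) members_subset_level[of M _ n] by (auto simp: superstructure_def simp del: level.simps)
  then have "{opair M a b | a b. a \<in> members M X \<and> b \<in> members M Y} \<subseteq> level M (Suc (Suc n))"
    using opair_superstructure(2)[OF assms(1)] by blast
  from coll_superstructure[OF assms(1) this]
  show "prod_obj M X Y \<in> univ M - atoms M"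
    "members M (prod_obj M X Y) = {opair M a b | a b. a \<in> members M X \<and> b \<in> members M Y}"
    by (auto simp: prod_obj_def)
qed

text \<open>Atoms are excluded because, having no members, they would count as subsets. In the
  enlargement, members of the star image of this object are internal directly by the definition of
  \<open>internal\<close>.\<close>

definition pow_obj :: "'a ustruct \<Rightarrow> 'a \<Rightarrow> 'a" where
  "pow_obj M Y = coll M {s \<in> univ M - atoms M. members M s \<subseteq> members M Y}"

lemma pow_obj_superstructure:
  assumes "superstructure M" "Y \<in> univ M"
  shows "pow_obj M Y \<in> univ M - atoms M"
    "members M (pow_obj M Y) = {s \<in> univ M - atoms M. members M s \<subseteq> members M Y}"
proof -
  obtain n where "Y \<in> level M n" using ex_level assms by metis
  then have "members M Y \<subseteq> level M n"
    using assms(1) members_subset_level[of M _ n] by (auto simp: superstructure_def simp del: level.simps)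
  then have "{s \<in> univ M - atoms M. members M s \<subseteq> members M Y} \<subseteq> level M (Suc n)"
    by auto
  from coll_superstructure[OF assms(1) this]
  show "pow_obj M Y \<in> univ M - atoms M"
    "members M (pow_obj M Y) = {s \<in> univ M - atoms M. members M s \<subseteq> members M Y}"
    by (auto simp: pow_obj_def)
qed


section \<open>Bounded formulas for pairs and triples\<close>

text \<open>
  In the formulas below, \<open>K\<close> stands for the set of atoms and \<open>P\<close> for the set of pairs of natural
  numbers. Bound variables are numbered from 99 on; the arguments must not contain them.
\<close>

definition pairF :: "'a \<Rightarrow> 'a trm \<Rightarrow> 'a trm \<Rightarrow> 'a trm \<Rightarrow> 'a bfm" where
  "pairF K p s t = BAnd (BNot (BMem p (Cst K)))
     (BEx 101 p (BEx 102 p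
       (BAnd (BNot (BMem (Var 101) (Cst K)))
       (BAnd (BNot (BMem (Var 102) (Cst K)))
       (BAnd (BAll 103 p (BOr (BEq (Var 103) (Var 101)) (BEq (Var 103) (Var 102))))
       (BAnd (BAnd (BMem s (Var 101)) (BAll 103 (Var 101) (BEq (Var 103) s)))
         (BAnd (BMem s (Var 102)) (BAnd (BMem t (Var 102))
           (BAll 103 (Var 102) (BOr (BEq (Var 103) s) (BEq (Var 103) t)))))))))))"

text \<open>The inner pair ranges over the fixed set \<open>P\<close>. This keeps the quantifier
  bounded and supplies an object whose pairing with the last component is known to exist.\<close>

definition tripF :: "'a \<Rightarrow> 'a \<Rightarrow> 'a trm \<Rightarrow> 'a trm \<Rightarrow> 'a trm \<Rightarrow> 'a trm \<Rightarrow> 'a bfm" where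
  "tripF K P p s t u =
     BEx 100 (Cst P) (BAnd (pairF K (Var 100) s t) (pairF K p (Var 100) u))"

definition relF :: "'a \<Rightarrow> 'a \<Rightarrow> 'a trm \<Rightarrow> 'a trm \<Rightarrow> 'a bfm" where
  "relF K R s t = BEx 100 (Cst R) (pairF K (Var 100) s t)"

text \<open>Formulas have no function symbols, so an operation occurs through its graph
  \<open>G\<close>, with \<open>u\<close> as the value.\<close>

definition opF :: "'a \<Rightarrow> 'a \<Rightarrow> 'a \<Rightarrow> 'a trm \<Rightarrow> 'a trm \<Rightarrow> 'a trm \<Rightarrow> 'a bfm" where
  "opF K P G s t u = BEx 99 (Cst G) (tripF K P (Var 99) s t u)"

definition iffF :: "'a bfm \<Rightarrow> 'a bfm \<Rightarrow> 'a bfm" where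
  "iffF \<phi> \<psi> = BAnd (BImp \<phi> \<psi>) (BImp \<psi> \<phi>)"

section \<open>Constants and free variables of the formulas\<close>

lemma iffF [simp]:
  "map_bfm f (iffF \<phi> \<psi>) = iffF (map_bfm f \<phi>) (map_bfm f \<psi>)"
  "set_bfm (iffF \<phi> \<psi>) = set_bfm \<phi> \<union> set_bfm \<psi>"
  "bfv (iffF \<phi> \<psi>) = bfv \<phi> \<union> bfv \<psi>"
  "bsat M e (iffF \<phi> \<psi>) \<longleftrightarrow> (bsat M e \<phi> \<longleftrightarrow> bsat M e \<psi>)"
  by (auto simp: iffF_def)

lemma map_bfm_formulas [simp]:
  "map_bfm f (pairF K p s t) = pairF (f K) (map_trm f p) (map_trm f s) (map_trm f t)"
  "map_bfm f (tripF K P p s t u) =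
     tripF (f K) (f P) (map_trm f p) (map_trm f s) (map_trm f t) (map_trm f u)"
  "map_bfm f (relF K R s t) = relF (f K) (f R) (map_trm f s) (map_trm f t)"
  "map_bfm f (opF K P G s t u) =
     opF (f K) (f P) (f G) (map_trm f s) (map_trm f t) (map_trm f u)"
  by (simp_all add: pairF_def tripF_def relF_def opF_def)

lemma set_bfm_formulas [simp]:
  "set_bfm (pairF K p s t) = insert K (set_trm p \<union> set_trm s \<union> set_trm t)"
  "set_bfm (tripF K P p s t u) = {K, P} \<union> (set_trm p \<union> set_trm s \<union> set_trm t \<union> set_trm u)"
  "set_bfm (relF K R s t) = {K, R} \<union> (set_trm s \<union> set_trm t)"
  "set_bfm (opF K P G s t u) = {K, P, G} \<union> (set_trm s \<union> set_trm t \<union> set_trm u)"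
  by (auto simp: pairF_def tripF_def relF_def opF_def)

text \<open>Each bound variable has a smaller number than those bound inside the nested formula, so
  it is itself an admissible argument there; hence the bounds 99, 100, 101.\<close>

lemma bfv_formulas:
  "tfv p \<union> tfv s \<union> tfv t \<subseteq> {..<101} \<Longrightarrow> bfv (pairF K p s t) = tfv p \<union> tfv s \<union> tfv t"
  "tfv p \<union> tfv s \<union> tfv t \<union> tfv u \<subseteq> {..<100} \<Longrightarrow>
     bfv (tripF K P p s t u) = tfv p \<union> tfv s \<union> tfv t \<union> tfv u"
  "tfv s \<union> tfv t \<subseteq> {..<100} \<Longrightarrow> bfv (relF K R s t) = tfv s \<union> tfv t"
  "tfv s \<union> tfv t \<union> tfv u \<subseteq> {..<99} \<Longrightarrow> bfv (opF K P G s t u) = tfv s \<union> tfv t \<union> tfv u"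
proof -
  have pair: "bfv (pairF K p s t) = tfv p \<union> tfv s \<union> tfv t"
    if "tfv p \<union> tfv s \<union> tfv t \<subseteq> {..<101}" for p s t :: "'a trm"
    using that by (fastforce simp: pairF_def)
  have trip: "bfv (tripF K P p s t u) = tfv p \<union> tfv s \<union> tfv t \<union> tfv u"
    if h: "tfv p \<union> tfv s \<union> tfv t \<union> tfv u \<subseteq> {..<100}" for p s t u :: "'a trm"
  proof -
    have "tfv p \<union> tfv s \<union> tfv t \<union> tfv u \<subseteq> {..<101}" using h by fastforce
    then have "bfv (tripF K P p s t u) = (tfv p \<union> tfv s \<union> tfv t \<union> tfv u \<union> {100}) - {100}"
      unfolding tripF_def by (auto simp: pair)
    with h show ?thesis by auto
  qed
  show "tfv p \<union> tfv s \<union> tfv t \<subseteq> {..<101} \<Longrightarrow> bfv (pairF K p s t) = tfv p \<union> tfv s \<union> tfv t"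
    by (rule pair)
  show "tfv p \<union> tfv s \<union> tfv t \<union> tfv u \<subseteq> {..<100} \<Longrightarrow>
     bfv (tripF K P p s t u) = tfv p \<union> tfv s \<union> tfv t \<union> tfv u" by (rule trip)
  show "bfv (relF K R s t) = tfv s \<union> tfv t" if h: "tfv s \<union> tfv t \<subseteq> {..<100}"
  proof -
    have "tfv s \<union> tfv t \<subseteq> {..<101}" using h by fastforce
    then have "bfv (relF K R s t) = (tfv s \<union> tfv t \<union> {100}) - {100}"
      unfolding relF_def by (auto simp: pair)
    with h show ?thesis by auto
  qed
  show "bfv (opF K P G s t u) = tfv s \<union> tfv t \<union> tfv u" if h: "tfv s \<union> tfv t \<union> tfv u \<subseteq> {..<99}"
  proof -
    have "tfv s \<union> tfv t \<union> tfv u \<subseteq> {..<100}" using h by fastforce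
    then have "bfv (opF K P G s t u) = (tfv s \<union> tfv t \<union> tfv u \<union> {99}) - {99}"
      unfolding opF_def by (auto simp: trip)
    with h show ?thesis by auto
  qed
qed

lemma tval_fresh: "v \<notin> tfv t \<Longrightarrow> tval (e(v := a)) t = tval e t"
  by (cases t) auto

lemma tfv_map_trm [simp]: "tfv (map_trm f t) = tfv t"
  by (cases t) auto

lemma bfv_map_bfm [simp]: "bfv (map_bfm f \<phi>) = bfv \<phi>"
  by (induction \<phi>) auto

lemma tval_cong: "(\<And>v. v \<in> tfv t \<Longrightarrow> e v = e' v) \<Longrightarrow> tval e t = tval e' t"
  by (cases t) auto

text \<open>Coincidence lemma. It removes auxiliary variables, such as the one holding a candidate
  set, from an assignment.\<close>

lemma bsat_cong: "(\<And>v. v \<in> bfv \<phi> \<Longrightarrow> e v = e' v) \<Longrightarrow> bsat M e \<phi> = bsat M e' \<phi>"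
proof (induction \<phi> arbitrary: e e')
  case (BMem s t)
  then have "tval e s = tval e' s" "tval e t = tval e' t" by (auto intro!: tval_cong)
  then show ?case by simp
next
  case (BEq s t)
  then have "tval e s = tval e' s" "tval e t = tval e' t" by (auto intro!: tval_cong)
  then show ?case by simp
next
  case (BNot \<phi>)
  have "bsat M e \<phi> = bsat M e' \<phi>" by (rule BNot.IH) (use BNot.prems in auto)
  then show ?case by simp
next
  case (BAnd \<phi> \<psi>)
  have "bsat M e \<phi> = bsat M e' \<phi>" by (rule BAnd.IH) (use BAnd.prems in auto)
  moreover have "bsat M e \<psi> = bsat M e' \<psi>" by (rule BAnd.IH) (use BAnd.prems in auto)
  ultimately show ?case by simp
next
  case (BOr \<phi> \<psi>)
  have "bsat M e \<phi> = bsat M e' \<phi>" by (rule BOr.IH) (use BOr.prems in auto)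
  moreover have "bsat M e \<psi> = bsat M e' \<psi>" by (rule BOr.IH) (use BOr.prems in auto)
  ultimately show ?case by simp
next
  case (BImp \<phi> \<psi>)
  have "bsat M e \<phi> = bsat M e' \<phi>" by (rule BImp.IH) (use BImp.prems in auto)
  moreover have "bsat M e \<psi> = bsat M e' \<psi>" by (rule BImp.IH) (use BImp.prems in auto)
  ultimately show ?case by simp
next
  case (BAll v t \<phi>)
  have "tval e t = tval e' t" by (rule tval_cong) (use BAll.prems in auto)
  moreover have "bsat M (e(v := a)) \<phi> = bsat M (e'(v := a)) \<phi>" for a
    by (rule BAll.IH) (use BAll.prems in auto)
  ultimately show ?case by simp
next
  case (BEx v t \<phi>)
  have "tval e t = tval e' t" by (rule tval_cong) (use BEx.prems in auto)
  moreover have "bsat M (e(v := a)) \<phi> = bsat M (e'(v := a)) \<phi>" for a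
    by (rule BEx.IH) (use BEx.prems in auto)
  ultimately show ?case by simp
qed

text \<open>The hypotheses on \<open>M\<close> and \<open>K\<close> hold in the base and in the
  enlargement, so the formula means the same in both. This absoluteness is what carries
  \<open>is_pair\<close> through transfer.\<close>

lemma bsat_pairF:
  assumes "set_structure M" "members M K = atoms M"
    and "tval e p \<in> univ M" "tval e s \<in> univ M" "tval e t \<in> univ M"
    and "tfv p \<union> tfv s \<union> tfv t \<subseteq> {..<101}"
  shows "bsat M e (pairF K p s t) = is_pair M (tval e p) (tval e s) (tval e t)"
proof -
  have fresh: "tval (e(v := a)) p = tval e p" "tval (e(v := a)) s = tval e s"
    "tval (e(v := a)) t = tval e t" if "101 \<le> v" for e :: "nat \<Rightarrow> 'a" and v a
    using assms(6) that by (auto intro!: tval_fresh)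
  have mem: "elem M x u \<longleftrightarrow> x \<in> members M u" if "x \<in> univ M" for x u
    using that by (auto simp: members_def)
  have sub: "x \<in> univ M" if "x \<in> members M u" for x u
    using that by (auto simp: members_def)
  \<comment> \<open>Equality with a set of at most two elements, in the bounded form that
    \<open>pairF\<close> spells out.\<close>
  have set1: "S = {x} \<longleftrightarrow> x \<in> S \<and> (\<forall>y\<in>S. y = x)" for S :: "'a set" and x by blast
  have set2: "S = {x, y} \<longleftrightarrow> x \<in> S \<and> y \<in> S \<and> (\<forall>z\<in>S. z = x \<or> z = y)" for S :: "'a set" and x y
    by blast
  have "bsat M e (pairF K p s t) \<longleftrightarrow> tval e p \<notin> atoms M \<and>
      (\<exists>u \<in> members M (tval e p). \<exists>v \<in> members M (tval e p). u \<notin> atoms M \<and> v \<notin> atoms M \<and>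
        (\<forall>w \<in> members M (tval e p). w = u \<or> w = v) \<and>
        members M u = {tval e s} \<and> members M v = {tval e s, tval e t})"
    unfolding pairF_def set1 set2
    by (simp add: fresh assms(2) mem sub assms(3-5) cong: bex_cong)
  also have "\<dots> \<longleftrightarrow> is_pair M (tval e p) (tval e s) (tval e t)"
    unfolding is_pair_def set2[of "members M (tval e p)"] using assms(3) sub by (safe; blast)
  finally show ?thesis .
qed

text \<open>Common ground for N in the base and the hypernaturals in the enlargement, with
  \<open>C\<close> as the set of numbers. The last two assumptions ask for existence of exactly
  those pairs that tuples of numbers use: in the base they follow from fullness, in the enlargement
  from transfer.\<close>

locale pairing =
  fixes M :: "'a ustruct" and K P :: 'a and C :: "'a set"
  assumes set_structure: "set_structure M"
    and atoms: "members M K = atoms M"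
    and C_univ: "C \<subseteq> univ M"
    and P: "members M P = {opair M a b | a b. a \<in> C \<and> b \<in> C}"
    and pair: "\<And>a b. a \<in> C \<Longrightarrow> b \<in> C \<Longrightarrow> is_pair M (opair M a b) a b"
    and triple: "\<And>q c. q \<in> members M P \<Longrightarrow> c \<in> C \<Longrightarrow> is_pair M (opair M q c) q c"
begin

lemma opair_inject:
  assumes "a \<in> C" "b \<in> C" "c \<in> C" "d \<in> C"
  shows "opair M a b = opair M c d \<longleftrightarrow> a = c \<and> b = d"
  using is_pair_inject[OF pair[OF assms(1,2)], of c d] pair[OF assms(3,4)] by auto

lemma otriple_inject:
  assumes "a \<in> C" "b \<in> C" "c \<in> C" "a' \<in> C" "b' \<in> C" "c' \<in> C"
  shows "otriple M a b c = otriple M a' b' c' \<longleftrightarrow> a = a' \<and> b = b' \<and> c = c'"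
proof
  assume eq: "otriple M a b c = otriple M a' b' c'"
  have "opair M a b \<in> members M P" "opair M a' b' \<in> members M P" using assms by (auto simp: P)
  from triple[OF this(1) assms(3)] triple[OF this(2) assms(6)]
  have "opair M a b = opair M a' b' \<and> c = c'"
    using eq is_pair_inject unfolding otriple_def by simp
  then show "a = a' \<and> b = b' \<and> c = c'" using assms by (simp add: opair_inject)
qed simp

lemma is_pair_iff:
  assumes "a \<in> C \<or> a \<in> members M P" "b \<in> C"
  shows "is_pair M p a b \<longleftrightarrow> p = opair M a b"
proof -
  have "is_pair M (opair M a b) a b" using assms pair triple by blast
  then show ?thesis using opair_eqI[OF set_structure] by blast
qed

lemma bsat_pairF':
  assumes "tval e p \<in> univ M" "tval e s \<in> C" "tval e t \<in> C"
    and "tfv p \<union> tfv s \<union> tfv t \<subseteq> {..<101}"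
  shows "bsat M e (pairF K p s t) \<longleftrightarrow> tval e p = opair M (tval e s) (tval e t)"
  using assms C_univ by (subst bsat_pairF[OF set_structure atoms]) (auto simp: is_pair_iff)

lemma bsat_tripF:
  assumes "tval e p \<in> univ M" "tval e s \<in> C" "tval e t \<in> C" "tval e u \<in> C"
    and "tfv p \<union> tfv s \<union> tfv t \<union> tfv u \<subseteq> {..<100}"
  shows "bsat M e (tripF K P p s t u) \<longleftrightarrow> tval e p = otriple M (tval e s) (tval e t) (tval e u)"
proof -
  have fresh: "tval (e(100 := a)) x = tval e x" if "x \<in> {p, s, t, u}" for x a
    using assms(5) that by (auto intro!: tval_fresh)
  have sub: "tfv p \<union> tfv s \<union> tfv t \<union> tfv u \<subseteq> {..<101}" using assms(5) by fastforce
  have uni: "a \<in> univ M" if "a \<in> members M P" for a using that by (auto simp: members_def)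
  have 1: "bsat M (e(100 := a)) (pairF K (Var 100) s t) \<longleftrightarrow> a = opair M (tval e s) (tval e t)"
    if "a \<in> members M P" for a
    using that assms sub by (subst bsat_pairF') (auto simp: fresh uni)
  \<comment> \<open>The first component is now a pair, hence in \<open>P\<close> and not known to be
    in \<open>C\<close>, so the argument returns to \<open>is_pair\<close>.\<close>
  have 2: "bsat M (e(100 := a)) (pairF K p (Var 100) u) \<longleftrightarrow> tval e p = opair M a (tval e u)"
    if "a \<in> members M P" for a
  proof -
    have "bsat M (e(100 := a)) (pairF K p (Var 100) u) \<longleftrightarrow> is_pair M (tval e p) a (tval e u)"
      using that assms sub C_univ
      by (subst bsat_pairF[OF set_structure atoms]) (auto simp: fresh uni)
    with that assms show ?thesis by (simp add: is_pair_iff)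
  qed
  show ?thesis
    unfolding tripF_def otriple_def using assms(2,3) by (auto simp: 1 2 P)
qed

lemma bsat_relF:
  assumes "tval e s \<in> C" "tval e t \<in> C" and "tfv s \<union> tfv t \<subseteq> {..<100}"
  shows "bsat M e (relF K R s t) \<longleftrightarrow> opair M (tval e s) (tval e t) \<in> members M R"
proof -
  have fresh: "tval (e(100 := a)) x = tval e x" if "x \<in> {s, t}" for x a
    using assms(3) that by (auto intro!: tval_fresh)
  have sub: "tfv s \<union> tfv t \<subseteq> {..<101}" using assms(3) by fastforce
  have "bsat M (e(100 := a)) (pairF K (Var 100) s t) \<longleftrightarrow> a = opair M (tval e s) (tval e t)"
    if "a \<in> members M R" for a
    using that assms sub members_subset_univ[of M R]
    by (subst bsat_pairF') (auto simp: fresh)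
  then show ?thesis unfolding relF_def by auto
qed

lemma bsat_opF:
  assumes "tval e s \<in> C" "tval e t \<in> C" "tval e u \<in> C" and "tfv s \<union> tfv t \<union> tfv u \<subseteq> {..<99}"
  shows "bsat M e (opF K P G s t u) \<longleftrightarrow>
    otriple M (tval e s) (tval e t) (tval e u) \<in> members M G"
proof -
  have fresh: "tval (e(99 := a)) x = tval e x" if "x \<in> {s, t, u}" for x a
    using assms(4) that by (auto intro!: tval_fresh)
  have sub: "tfv s \<union> tfv t \<union> tfv u \<subseteq> {..<100}" using assms(4) by fastforce
  have "bsat M (e(99 := a)) (tripF K P (Var 99) s t u) \<longleftrightarrow>
      a = otriple M (tval e s) (tval e t) (tval e u)"
    if "a \<in> members M G" for a
    using that assms sub members_subset_univ[of M G]
    by (subst bsat_tripF) (auto simp: fresh)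
  then show ?thesis unfolding opF_def by auto
qed

end

text \<open>Peels one quantifier off a transferred sentence without evaluating the formula below it,
  which keeps large bodies folded.\<close>

lemma bsat_BAllD:
  assumes "bsat M e (map_bfm f (BAll v (Cst c) \<phi>))" "a \<in> members M (f c)"
  shows "bsat M (e(v := a)) (map_bfm f \<phi>)"
  using assms by simp


section \<open>Consequences of transfer\<close>

locale nonstandard =
  fixes E :: "('a, 'b) nsm"
  assumes nonstandard: "nonstandard_model E"
begin

abbreviation "B \<equiv> base E"
abbreviation "H \<equiv> enl E"
abbreviation "nat_of \<equiv> inv (natom E)"

section \<open>Objects of the base structure that serve as constants\<close>

definition AT :: 'a where "AT = coll B (atoms B)"
definition NN :: 'a where "NN = coll B (range (natom E))"
definition NP :: 'a where "NP = prod_obj B NN NN"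

text \<open>Together with \<open>graph\<close>, this names the collections inside \<open>hle\<close>
  and \<open>hop\<close>, so that their star images become the constants of transferred
  formulas.\<close>

definition rel :: "(nat \<Rightarrow> nat \<Rightarrow> bool) \<Rightarrow> 'a" where
  "rel R = coll B {opair B (natom E m) (natom E n) | m n. R m n}"

definition graph :: "(nat \<Rightarrow> nat \<Rightarrow> nat) \<Rightarrow> 'a" where
  "graph f = coll B {otriple B (natom E m) (natom E n) (natom E (f m n)) | m n. True}"

abbreviation "LE \<equiv> relF AT (rel (\<le>))"
abbreviation "PL \<equiv> opF AT NP (graph (+))"
abbreviation "MI \<equiv> opF AT NP (graph (-))"
abbreviation "num p \<equiv> Cst (natom E p)"

lemma superstructure_base: "superstructure B"
  and set_structure_enl: "set_structure H"
  and inj_natom: "inj (natom E)"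
  and natom_atoms: "natom E n \<in> atoms B"
  using nonstandard by (simp_all add: nonstandard_model_def image_subset_iff)

lemma set_structure_base: "set_structure B"
  using superstructure_base by (simp add: superstructure_def)

lemma natom_eq_iff [simp]: "natom E m = natom E n \<longleftrightarrow> m = n"
  using inj_natom by (auto dest: injD)

lemma nat_of_natom [simp]: "nat_of (natom E n) = n"
  using inj_natom by simp

lemma natom_univ [simp]: "natom E n \<in> univ B"
  using natom_atoms set_structure_base by (auto simp: set_structure_def)

lemma star_univ [simp]: "x \<in> univ B \<Longrightarrow> star E x \<in> univ H"
  using nonstandard by (auto simp: nonstandard_model_def)

lemma AT [simp]: "AT \<in> univ B" "members B AT = atoms B"
  using coll_superstructure[OF superstructure_base, of "atoms B" 0] by (auto simp: AT_def)

lemma members_star_AT [simp]: "members H (star E AT) = atoms H"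
  using nonstandard by (simp add: nonstandard_model_def AT_def)

lemma NN [simp]: "NN \<in> univ B" "members B NN = range (natom E)"
proof -
  have "range (natom E) \<subseteq> level B 0" using natom_atoms by auto
  from coll_superstructure[OF superstructure_base this]
  show "NN \<in> univ B" "members B NN = range (natom E)" by (auto simp: NN_def)
qed

lemma members_star_NN [simp]: "members H (star E NN) = hnat E"
  by (simp add: hnat_def NN_def)

lemma NP [simp]: "NP \<in> univ B"
  "members B NP = {opair B a b | a b. a \<in> range (natom E) \<and> b \<in> range (natom E)}"
  using prod_obj_superstructure[OF superstructure_base, of NN NN] by (auto simp: NP_def)

lemma rel: "rel R \<in> univ B" "members B (rel R) = {opair B (natom E m) (natom E n) | m n. R m n}"
proof -
  have "natom E n \<in> level B 0" for n using natom_atoms by simp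
  then have "{opair B (natom E m) (natom E n) | m n. R m n} \<subseteq> level B (Suc (Suc 0))"
    using opair_superstructure(2)[OF superstructure_base] by blast
  from coll_superstructure[OF superstructure_base this]
  show "rel R \<in> univ B" "members B (rel R) = {opair B (natom E m) (natom E n) | m n. R m n}"
    by (auto simp: rel_def)
qed

lemma graph: "graph f \<in> univ B"
  "members B (graph f) = {otriple B (natom E m) (natom E n) (natom E (f m n)) | m n. True}"
proof -
  have 0: "natom E n \<in> level B 0" for n using natom_atoms by simp
  have 1: "opair B (natom E m) (natom E n) \<in> level B (Suc (Suc 0))" for m n
    by (rule opair_superstructure[OF superstructure_base 0 0])
  have 2: "natom E n \<in> level B (Suc (Suc 0))" for n using 0 by simp
  have "{otriple B (natom E m) (natom E n) (natom E (f m n)) | m n. True}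
      \<subseteq> level B (Suc (Suc (Suc (Suc 0))))"
    unfolding otriple_def using opair_superstructure(2)[OF superstructure_base 1 2] by blast
  from coll_superstructure[OF superstructure_base this]
  show "graph f \<in> univ B"
    "members B (graph f) = {otriple B (natom E m) (natom E n) (natom E (f m n)) | m n. True}"
    by (auto simp: graph_def)
qed

lemmas object_univ [simp] = rel(1) graph(1)

lemma transfer:
  assumes "bfv \<phi> = {}" "set_bfm \<phi> \<subseteq> univ B" "\<And>e. bsat B e \<phi>"
  shows "bsat H e (map_bfm (star E) \<phi>)"
  using assms nonstandard
  by (simp add: nonstandard_model_def transfer_principle_def bsentence_def btrue_def)

lemma members_star_iff: "x \<in> univ H \<Longrightarrow> elem H x y \<longleftrightarrow> x \<in> members H y"
  by (simp add: members_def)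

lemma hnat_univ: "a \<in> hnat E \<Longrightarrow> a \<in> univ H"
  by (simp add: hnat_def members_def)

text \<open>The first transferred sentence yields a pair for any two components, since the
  enlargement offers no fullness to build one; extensionality then makes it equal to
  \<open>opair\<close>. The general \<open>bsat_pairF\<close> is used because the
  \<open>pairing\<close> instance for the enlargement rests on this lemma.\<close>

lemma star_prod_obj:
  assumes "X \<in> univ B" "Y \<in> univ B"
  shows "a \<in> members H (star E X) \<Longrightarrow> b \<in> members H (star E Y) \<Longrightarrow> is_pair H (opair H a b) a b"
    and "members H (star E (prod_obj B X Y)) =
      {opair H a b | a b. a \<in> members H (star E X) \<and> b \<in> members H (star E Y)}"
proof -
  let ?XY = "prod_obj B X Y"
  note P = prod_obj_superstructure[OF superstructure_base assms]
  have XB: "x \<in> univ B" if "x \<in> members B z" for x z using that by (auto simp: members_def)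
  have XH: "x \<in> univ H" if "x \<in> members H z" for x z using that by (auto simp: members_def)
  let ?p = "pairF AT (Var 2) (Var 0) (Var 5)"
  have satB: "bsat B e ?p \<longleftrightarrow> is_pair B (e 2) (e 0) (e 5)"
    if "e 0 \<in> univ B" "e 5 \<in> univ B" "e 2 \<in> univ B" for e
    using that by (subst bsat_pairF) (auto simp: set_structure_base)
  have satH: "bsat H e (map_bfm (star E) ?p) \<longleftrightarrow> is_pair H (e 2) (e 0) (e 5)"
    if "e 0 \<in> univ H" "e 5 \<in> univ H" "e 2 \<in> univ H" for e
    using that by (simp, subst bsat_pairF) (auto simp: set_structure_enl)
  have fv: "bfv ?p = {0, 2, 5}" by (simp add: bfv_formulas insert_commute)
  have 1: "\<exists>p \<in> members H (star E ?XY). is_pair H p a b"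
    if "a \<in> members H (star E X)" "b \<in> members H (star E Y)" for a b
  proof -
    have "bsat H e (map_bfm (star E) (BAll 0 (Cst X) (BAll 5 (Cst Y) (BEx 2 (Cst ?XY) ?p))))" for e
    proof (rule transfer)
      have "\<exists>p \<in> members B ?XY. is_pair B p a b" if "a \<in> members B X" "b \<in> members B Y" for a b
        using is_pair_superstructure[OF superstructure_base XB[OF that(1)] XB[OF that(2)]] that
        by (auto simp: P(2))
      then show "bsat B e (BAll 0 (Cst X) (BAll 5 (Cst Y) (BEx 2 (Cst ?XY) ?p)))" for e
        by (simp add: satB XB cong: bex_cong)
    qed (use assms P in \<open>auto simp: fv\<close>)
    then show ?thesis using that by (simp del: map_bfm_formulas add: satH XH cong: bex_cong)
  qed
  have pair: "is_pair H (opair H a b) a b \<and> opair H a b \<in> members H (star E ?XY)"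
    if "a \<in> members H (star E X)" "b \<in> members H (star E Y)" for a b
  proof -
    from 1[OF that] obtain p where "p \<in> members H (star E ?XY)" "is_pair H p a b" by blast
    then show ?thesis by (simp add: opair_eqI[OF set_structure_enl])
  qed
  then show "a \<in> members H (star E X) \<Longrightarrow> b \<in> members H (star E Y) \<Longrightarrow>
      is_pair H (opair H a b) a b"
    by blast
  \<comment> \<open>The converse inclusion takes a transfer of its own, since the star of a product
    might a priori contain other objects.\<close>
  have 2: "\<exists>a \<in> members H (star E X). \<exists>b \<in> members H (star E Y). is_pair H p a b"
    if "p \<in> members H (star E ?XY)" for p
  proof -
    have "bsat H e (map_bfm (star E) (BAll 2 (Cst ?XY) (BEx 0 (Cst X) (BEx 5 (Cst Y) ?p))))" for e
    proof (rule transfer)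
      have "\<exists>a \<in> members B X. \<exists>b \<in> members B Y. is_pair B p a b" if "p \<in> members B ?XY" for p
      proof -
        obtain a b where "p = opair B a b" "a \<in> members B X" "b \<in> members B Y"
          using \<open>p \<in> members B ?XY\<close> unfolding P(2) by blast
        then show ?thesis using is_pair_superstructure[OF superstructure_base] XB by blast
      qed
      then show "bsat B e (BAll 2 (Cst ?XY) (BEx 0 (Cst X) (BEx 5 (Cst Y) ?p)))" for e
        by (simp add: satB XB cong: bex_cong)
    qed (use assms P in \<open>auto simp: fv\<close>)
    then show ?thesis using that by (simp del: map_bfm_formulas add: satH XH cong: bex_cong)
  qed
  show "members H (star E ?XY) =
      {opair H a b | a b. a \<in> members H (star E X) \<and> b \<in> members H (star E Y)}"
  proof (intro equalityI subsetI)
    fix p assume "p \<in> members H (star E ?XY)"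
    then obtain a b where "a \<in> members H (star E X)" "b \<in> members H (star E Y)" "is_pair H p a b"
      using 2 by blast
    then show "p \<in> {opair H a b | a b. a \<in> members H (star E X) \<and> b \<in> members H (star E Y)}"
      using opair_eqI[OF set_structure_enl, of p a b] by blast
  qed (use pair in blast)
qed

sublocale std: pairing B AT NP "range (natom E)"
proof
  show "is_pair B (opair B a b) a b" if "a \<in> range (natom E)" "b \<in> range (natom E)" for a b
    using that by (auto intro: is_pair_superstructure[OF superstructure_base])
  show "is_pair B (opair B q c) q c" if "q \<in> members B NP" "c \<in> range (natom E)" for q c
    using that members_subset_univ[of B NP]
    by (auto intro!: is_pair_superstructure[OF superstructure_base] simp del: NP(2))
qed (auto simp: set_structure_base)

text \<open>The products N x N and (N x N) x N give the two existence assumptions, for pairs and for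
  triples.\<close>

sublocale hyp: pairing H "star E AT" "star E NP" "hnat E"
  using star_prod_obj[OF NN(1) NN(1)] star_prod_obj[OF NP(1) NN(1)]
  by unfold_locales (auto simp: set_structure_enl hnat_univ NP_def)

text \<open>Decoding with \<open>nat_of\<close> turns truth in the base into arithmetic on type
  \<open>nat\<close>, where a sentence can be decided before it is transferred.\<close>

lemma bsat_base_LE:
  assumes "tval e s \<in> range (natom E)" "tval e t \<in> range (natom E)" "tfv s \<union> tfv t \<subseteq> {..<100}"
  shows "bsat B e (LE s t) \<longleftrightarrow> nat_of (tval e s) \<le> nat_of (tval e t)"
  using assms by (subst std.bsat_relF) (auto simp: rel std.opair_inject)

lemma bsat_base_op:
  assumes "tval e s \<in> range (natom E)" "tval e t \<in> range (natom E)" "tval e u \<in> range (natom E)"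
    "tfv s \<union> tfv t \<union> tfv u \<subseteq> {..<99}"
  shows "bsat B e (opF AT NP (graph f) s t u) \<longleftrightarrow>
    nat_of (tval e u) = f (nat_of (tval e s)) (nat_of (tval e t))"
  using assms by (subst std.bsat_opF) (auto simp: graph std.otriple_inject)

lemma bsat_enl_LE:
  assumes "tval e s \<in> hnat E" "tval e t \<in> hnat E" "tfv s \<union> tfv t \<subseteq> {..<100}"
  shows "bsat H e (relF (star E AT) (star E (rel (\<le>))) s t) \<longleftrightarrow> hle E (tval e s) (tval e t)"
  using assms by (subst hyp.bsat_relF) (auto simp: hle_def rel_def)

lemma hstd_hnat [simp]: "star E (natom E p) \<in> hnat E"
proof -
  have "bsat H undefined (map_bfm (star E) (BMem (num p) (Cst NN)))"
  proof (rule transfer)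
    show "bsat B e (BMem (num p) (Cst NN))" for e
      using NN(2) by (auto simp: members_def)
  qed auto
  then show ?thesis by (simp add: members_star_iff)
qed

text \<open>The description in \<open>hop\<close> is meaningful because functionality of the graph
  transfers; unique existence is written as a value together with a bounded comparison against all
  others.\<close>

lemma hop_char:
  assumes "a \<in> hnat E" "b \<in> hnat E"
  shows "hop E f a b \<in> hnat E"
    and "c \<in> hnat E \<Longrightarrow> otriple H a b c \<in> members H (star E (graph f)) \<longleftrightarrow> c = hop E f a b"
proof -
  let ?p = "opF AT NP (graph f) (Var 0) (Var 5)"
  have fv: "bfv (?p (Var n)) = {0, 5, n}" if "n < 99" for n
    using that by (subst bfv_formulas) auto
  have "bsat H e (map_bfm (star E) (BAll 0 (Cst NN) (BAll 5 (Cst NN) (BEx 2 (Cst NN)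
      (BAnd (?p (Var 2)) (BAll 3 (Cst NN) (BImp (?p (Var 3)) (BEq (Var 3) (Var 2)))))))))" for e
    by (rule transfer) (simp_all add: fv bsat_base_op Diff_subset_conv)
  then have "\<exists>d \<in> hnat E. otriple H a b d \<in> members H (star E (graph f)) \<and>
      (\<forall>c \<in> hnat E. otriple H a b c \<in> members H (star E (graph f)) \<longrightarrow> c = d)"
    using assms by (simp add: hyp.bsat_opF)
  then obtain d where d: "d \<in> hnat E" "otriple H a b d \<in> members H (star E (graph f))"
    and unique: "\<forall>c \<in> hnat E. otriple H a b c \<in> members H (star E (graph f)) \<longrightarrow> c = d"
    by (elim bexE conjE)
  have hop: "hop E f a b = d"
  proof -
    have "(THE c. c \<in> hnat E \<and> otriple H a b c \<in> members H (star E (graph f))) = d"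
      by (rule the_equality) (use d unique in blast)+
    then show ?thesis by (simp only: hop_def graph_def)
  qed
  show "hop E f a b \<in> hnat E" using d(1) by (simp only: hop)
  show "otriple H a b c \<in> members H (star E (graph f)) \<longleftrightarrow> c = hop E f a b" if "c \<in> hnat E"
    unfolding hop using d(2) unique that by blast
qed

lemma bsat_enl_op:
  assumes "tval e s \<in> hnat E" "tval e t \<in> hnat E" "tval e u \<in> hnat E"
    "tfv s \<union> tfv t \<union> tfv u \<subseteq> {..<99}"
  shows "bsat H e (opF (star E AT) (star E NP) (star E (graph f)) s t u) \<longleftrightarrow>
    tval e u = hop E f (tval e s) (tval e t)"
  using assms by (simp add: hyp.bsat_opF hop_char(2))

section \<open>Successor, predecessor and order on the hypernaturals\<close>

abbreviation "hsuc x \<equiv> hplus E x (hstd E 1)"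
abbreviation "hpred x \<equiv> hminus E x (hstd E 1)"

lemma hsuc_hnat: "x \<in> hnat E \<Longrightarrow> hsuc x \<in> hnat E"
  and hpred_hnat: "x \<in> hnat E \<Longrightarrow> hpred x \<in> hnat E"
  by (simp_all add: hplus_def hminus_def hop_char hstd_def)

lemma star_natom: "star E (natom E p) = hstd E p"
  by (simp add: hstd_def)

lemmas bsat_enl_PL = bsat_enl_op[of _ _ _ _ "(+)", folded hplus_def]
lemmas bsat_enl_MI = bsat_enl_op[of _ _ _ _ "(-)", folded hminus_def]

lemma hstd_in_hnat [simp]: "hstd E p \<in> hnat E"
  by (simp add: hstd_def)

text \<open>For lack of function symbols, successors and the predecessor are universally quantified
  variables tied to \<open>x\<close> and \<open>y\<close> by graph hypotheses. They are afterwards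
  instantiated with the actual values.\<close>

lemma arith:
  assumes "x \<in> hnat E" "y \<in> hnat E"
  shows "hle E (hstd E 0) x"
    and "hle E y (hsuc x) \<longleftrightarrow> hle E y x \<or> y = hsuc x"
    and "\<not> hle E (hsuc x) x"
    and "hsuc x = hsuc y \<longleftrightarrow> x = y"
    and "x \<noteq> hstd E 0 \<Longrightarrow> hsuc (hpred x) = x"
    and "x \<noteq> hstd E 0 \<Longrightarrow> hle E y (hpred x) \<longleftrightarrow> hle E y x \<and> y \<noteq> x"
    and "hle E x y \<Longrightarrow> x = y \<or> hle E (hsuc x) y"
    and "hsuc x \<noteq> hstd E 0"
    and "hle E (hsuc x) (hsuc y) \<longleftrightarrow> hle E x y"
    and "hle E (hstd E 1) x \<longleftrightarrow> x \<noteq> hstd E 0"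
    and "hle E x x"
proof -
  let ?x = "Var 0" and ?y = "Var 1" and ?sx = "Var 2" and ?sy = "Var 3" and ?px = "Var 4"
  let ?body = "BAnd (LE (num 0) ?x)
    (BAnd (iffF (LE ?y ?sx) (BOr (LE ?y ?x) (BEq ?y ?sx)))
    (BAnd (BNot (LE ?sx ?x))
    (BAnd (iffF (BEq ?sx ?sy) (BEq ?x ?y))
    (BAnd (BImp (BNot (BEq ?x (num 0))) (PL ?px (num 1) ?x))
    (BAnd (BImp (BNot (BEq ?x (num 0))) (iffF (LE ?y ?px) (BAnd (LE ?y ?x) (BNot (BEq ?y ?x)))))
    (BAnd (BImp (LE ?x ?y) (BOr (BEq ?x ?y) (LE ?sx ?y)))
    (BAnd (BNot (BEq ?sx (num 0)))
    (BAnd (iffF (LE ?sx ?sy) (LE ?x ?y))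
    (BAnd (iffF (LE (num 1) ?x) (BNot (BEq ?x (num 0))))
      (LE ?x ?x))))))))))"
  let ?s = "BAll 0 (Cst NN) (BAll 1 (Cst NN) (BAll 2 (Cst NN) (BAll 3 (Cst NN) (BAll 4 (Cst NN)
    (BImp (PL ?x (num 1) ?sx) (BImp (PL ?y (num 1) ?sy) (BImp (MI ?x (num 1) ?px) ?body)))))))"
  have "bsat H e (map_bfm (star E) ?s)" for e
  proof (rule transfer)
    \<comment> \<open>The guards on x = 0 matter because truncated subtraction gives 0 - 1 = 0.
      After evaluation the claim is linear arithmetic.\<close>
    show "bsat B e ?s" for e
      by (simp add: bsat_base_LE bsat_base_op) presburger
  qed (simp_all add: bfv_formulas Diff_subset_conv)
  note forall = this[of undefined]
  have m1: "x \<in> members H (star E NN)" and m2: "y \<in> members H (star E NN)"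
    and m3: "hsuc x \<in> members H (star E NN)" and m4: "hsuc y \<in> members H (star E NN)"
    and m5: "hpred x \<in> members H (star E NN)"
    unfolding members_star_NN by (intro assms hsuc_hnat hpred_hnat)+
  note inst = bsat_BAllD[OF bsat_BAllD[OF bsat_BAllD[OF bsat_BAllD[OF bsat_BAllD[OF forall
    m1] m2] m3] m4] m5]
  \<comment> \<open>At these values the three graph hypotheses become reflexive equations and drop
    out.\<close>
  have "bsat H (undefined(0 := x, 1 := y, 2 := hsuc x, 3 := hsuc y, 4 := hpred x)) (map_bfm (star E)
      (BImp (PL ?x (num 1) ?sx) (BImp (PL ?y (num 1) ?sy) (BImp (MI ?x (num 1) ?px) ?body))))
    \<longleftrightarrow> hle E (hstd E 0) x
    \<and> (hle E y (hsuc x) \<longleftrightarrow> hle E y x \<or> y = hsuc x)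
    \<and> (\<not> hle E (hsuc x) x)
    \<and> (hsuc x = hsuc y \<longleftrightarrow> x = y)
    \<and> (x \<noteq> hstd E 0 \<longrightarrow> x = hsuc (hpred x))
    \<and> (x \<noteq> hstd E 0 \<longrightarrow> (hle E y (hpred x) \<longleftrightarrow> hle E y x \<and> y \<noteq> x))
    \<and> (hle E x y \<longrightarrow> x = y \<or> hle E (hsuc x) y)
    \<and> (hsuc x \<noteq> hstd E 0)
    \<and> (hle E (hsuc x) (hsuc y) \<longleftrightarrow> hle E x y)
    \<and> (hle E (hstd E 1) x \<longleftrightarrow> x \<noteq> hstd E 0)
    \<and> (hle E x x)"
    by (simp add: bsat_enl_LE bsat_enl_PL bsat_enl_MI star_natom assms hsuc_hnat hpred_hnat
        del: One_nat_def)
  note all = iffD1[OF this inst]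
  from all show "hle E (hstd E 0) x" by blast
  from all show "hle E y (hsuc x) \<longleftrightarrow> hle E y x \<or> y = hsuc x" by blast
  from all show "\<not> hle E (hsuc x) x" by blast
  from all show "hsuc x = hsuc y \<longleftrightarrow> x = y" by blast
  from all have "x \<noteq> hstd E 0 \<longrightarrow> x = hsuc (hpred x)" by blast
  then show "x \<noteq> hstd E 0 \<Longrightarrow> hsuc (hpred x) = x" by (rule sym[OF mp])
  from all show "x \<noteq> hstd E 0 \<Longrightarrow> hle E y (hpred x) \<longleftrightarrow> hle E y x \<and> y \<noteq> x" by blast
  from all show "hle E x y \<Longrightarrow> x = y \<or> hle E (hsuc x) y" by blast
  from all show "hsuc x \<noteq> hstd E 0" by blast
  from all show "hle E (hsuc x) (hsuc y) \<longleftrightarrow> hle E x y" by blast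
  from all show "hle E (hstd E 1) x \<longleftrightarrow> x \<noteq> hstd E 0" by blast
  from all show "hle E x x" by blast
qed

lemma hstd_eq_iff [simp]: "hstd E m = hstd E n \<longleftrightarrow> m = n"
proof -
  have "bsat H undefined (map_bfm (star E) (BNot (BEq (num m) (num n))))" if "m \<noteq> n"
    by (rule transfer) (use that in auto)
  then show ?thesis by (auto simp: hstd_def)
qed

lemma hsuc_hstd: "hsuc (hstd E p) = hstd E (Suc p)"
proof -
  have "bsat H undefined (map_bfm (star E) (PL (num p) (num 1) (num (Suc p))))"
    by (rule transfer) (auto simp: bfv_formulas bsat_base_op)
  then show ?thesis by (simp add: bsat_enl_op hplus_def hstd_def)
qed


section \<open>The internal definition principle\<close>

text \<open>
  Variable 0 is the parameter; the defined elements are numbered 7 (elements of \<open>Y\<close>) or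
  3, 4, 5 (components of tuples of natural numbers).
\<close>

lemma internal_set_definable:
  assumes Y: "Y \<in> univ B" and l: "l \<in> hnat E"
    and fv: "bfv \<phi> \<subseteq> {0, 7}" and const: "set_bfm \<phi> \<subseteq> univ B"
  shows "internal_set E {y \<in> members H (star E Y). bsat H (e(0 := l, 7 := y)) (map_bfm (star E) \<phi>)}"
proof -
  let ?P = "pow_obj B Y"
  note P = pow_obj_superstructure[OF superstructure_base Y]
  \<comment> \<open>The equivalence controls only members of \<open>s\<close> that lie in
    \<open>Y\<close>, so the inclusion in \<open>Y\<close> is stated as well; the non-atom clause is
    there because \<open>internal_set\<close> asks for a set.\<close>
  let ?s = "BAll 0 (Cst NN) (BEx 2 (Cst ?P) (BAnd (BNot (BMem (Var 2) (Cst AT)))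
    (BAnd (BAll 3 (Var 2) (BMem (Var 3) (Cst Y)))
      (BAll 7 (Cst Y) (iffF (BMem (Var 7) (Var 2)) \<phi>)))))"
  have "bsat H e (map_bfm (star E) ?s)"
  proof (rule transfer)
    show "bfv ?s = {}" using fv by auto
    show "set_bfm ?s \<subseteq> univ B" using const Y P by auto
    show "bsat B e ?s" for e
    proof -
      have "\<exists>s \<in> members B ?P. s \<notin> atoms B \<and> (\<forall>z \<in> members B s. z \<in> members B Y) \<and>
        (\<forall>y \<in> members B Y. y \<in> members B s \<longleftrightarrow> bsat B (e(0 := natom E n, 2 := s, 7 := y)) \<phi>)" for n
      proof -
        \<comment> \<open>In the base, the desired set exists by fullness, since the members of
          \<open>Y\<close> lie in one level.\<close>
        define S where "S = {y \<in> members B Y. bsat B (e(0 := natom E n, 7 := y)) \<phi>}"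
        obtain k where "Y \<in> level B k" using Y ex_level[OF superstructure_base] by metis
        then have "S \<subseteq> level B k"
          using members_subset_level[OF set_structure_base] unfolding S_def by blast
        note s = coll_superstructure[OF superstructure_base this]
        have sat: "bsat B (e(0 := natom E n, 2 := s, 7 := y)) \<phi> \<longleftrightarrow>
            bsat B (e(0 := natom E n, 7 := y)) \<phi>" for s y
          by (rule bsat_cong) (use fv in auto)
        have "S \<subseteq> members B Y" by (auto simp: S_def)
        then have "coll B S \<in> members B ?P" using s by (simp add: P(2))
        moreover have "coll B S \<notin> atoms B" using s by simp
        moreover have "\<forall>z \<in> members B (coll B S). z \<in> members B Y"
          using \<open>S \<subseteq> members B Y\<close> s(2) by blast
        moreover have "\<forall>y \<in> members B Y. y \<in> members B (coll B S) \<longleftrightarrow>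
            bsat B (e(0 := natom E n, 2 := coll B S, 7 := y)) \<phi>"
          unfolding s(2) sat by (simp add: S_def)
        ultimately show ?thesis by blast
      qed
      moreover have "elem B z x \<longleftrightarrow> z \<in> members B x" if "z \<in> members B w" for z x w
        using that by (auto simp: members_def)
      ultimately show ?thesis
        by (auto simp: AT(2)[symmetric] simp del: AT(2) cong: bex_cong)
    qed
  qed
  then have "\<exists>s \<in> members H (star E ?P). \<not> elem H s (star E AT) \<and>
      (\<forall>z \<in> members H s. elem H z (star E Y)) \<and>
      (\<forall>y \<in> members H (star E Y). elem H y s \<longleftrightarrow>
        bsat H (e(0 := l, 2 := s, 7 := y)) (map_bfm (star E) \<phi>))"
    using l by simp
  then obtain s where s: "s \<in> members H (star E ?P)" "\<not> elem H s (star E AT)"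
      "\<forall>z \<in> members H s. elem H z (star E Y)"
    and mem: "\<forall>y \<in> members H (star E Y). elem H y s \<longleftrightarrow>
        bsat H (e(0 := l, 2 := s, 7 := y)) (map_bfm (star E) \<phi>)"
    by (elim bexE conjE)
  have sat: "bsat H (e(0 := l, 2 := s, 7 := y)) (map_bfm (star E) \<phi>) \<longleftrightarrow>
      bsat H (e(0 := l, 7 := y)) (map_bfm (star E) \<phi>)" for y
    by (rule bsat_cong) (use fv in auto)
  \<comment> \<open>Membership in the star of the power set is already the witness of
    internality.\<close>
  have "s \<in> univ H" "elem H s (star E ?P)" using s(1) by (auto simp: members_def)
  moreover have "s \<notin> atoms H"
    using s(2) \<open>s \<in> univ H\<close> members_star_iff by (simp flip: members_star_AT)
  moreover have "members H s = {y \<in> members H (star E Y). bsat H (e(0 := l, 7 := y)) (map_bfm (star E) \<phi>)}"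
    using s(3) mem unfolding sat by (auto simp: members_def)
  ultimately show ?thesis
    unfolding internal_set_def internal_def using P(1) by blast
qed

text \<open>The definition principle is applied to the set of pairs of naturals, with the components
  as bounded existential variables. Its star contains every pair of hypernaturals, so no element of
  the relation is lost.\<close>

lemma internal_rel2_definable:
  assumes l: "l \<in> hnat E" and fv: "bfv \<phi> \<subseteq> {0, 3, 4}" and const: "set_bfm \<phi> \<subseteq> univ B"
  shows "internal_rel2 E {(a, b). a \<in> hnat E \<and> b \<in> hnat E \<and>
    bsat H (e(0 := l, 3 := a, 4 := b)) (map_bfm (star E) \<phi>)}" (is "internal_rel2 E ?R")
proof -
  let ?\<psi> = "BEx 3 (Cst NN) (BEx 4 (Cst NN) (BAnd (pairF AT (Var 7) (Var 3) (Var 4)) \<phi>))"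
  have "bfv ?\<psi> \<subseteq> {0, 7}" "set_bfm ?\<psi> \<subseteq> univ B"
    using fv const by (auto simp: bfv_formulas)
  note internal = internal_set_definable[OF NP(1) l this, of e]
  have sat: "bsat H (e(0 := l, 7 := y, 3 := a, 4 := b)) (map_bfm (star E) \<phi>) \<longleftrightarrow>
      bsat H (e(0 := l, 3 := a, 4 := b)) (map_bfm (star E) \<phi>)" for y a b
    by (rule bsat_cong) (use fv in auto)
  have "bsat H (e(0 := l, 7 := y)) (map_bfm (star E) ?\<psi>) \<longleftrightarrow>
      (\<exists>a \<in> hnat E. \<exists>b \<in> hnat E. y = opair H a b \<and> (a, b) \<in> ?R)"
    if "y \<in> members H (star E NP)" for y
  proof -
    have "y \<in> univ H" using that by (simp add: members_def)
    then show ?thesis by (simp add: hyp.bsat_pairF' sat)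
  qed
  moreover have "opair H a b \<in> members H (star E NP)" if "a \<in> hnat E" "b \<in> hnat E" for a b
    using that by (auto simp: hyp.P)
  ultimately have "{y \<in> members H (star E NP). bsat H (e(0 := l, 7 := y)) (map_bfm (star E) ?\<psi>)} =
      {opair H a b | a b. (a, b) \<in> ?R}"
    by blast
  with internal show ?thesis unfolding internal_rel2_def by (simp only:)
qed

text \<open>The ambient product is (N x N) x N, matching the nesting of
  \<open>otriple\<close>.\<close>

lemma internal_rel3_definable:
  assumes l: "l \<in> hnat E" and fv: "bfv \<phi> \<subseteq> {0, 3, 4, 5}" and const: "set_bfm \<phi> \<subseteq> univ B"
  shows "internal_rel3 E {(a, b, c). a \<in> hnat E \<and> b \<in> hnat E \<and> c \<in> hnat E \<and>
    bsat H (e(0 := l, 3 := a, 4 := b, 5 := c)) (map_bfm (star E) \<phi>)}" (is "internal_rel3 E ?R")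
proof -
  let ?\<psi> = "BEx 3 (Cst NN) (BEx 4 (Cst NN) (BEx 5 (Cst NN)
    (BAnd (tripF AT NP (Var 7) (Var 3) (Var 4) (Var 5)) \<phi>)))"
  let ?Y = "prod_obj B NP NN"
  have Y: "?Y \<in> univ B" using prod_obj_superstructure(1)[OF superstructure_base NP(1) NN(1)] by simp
  have "bfv ?\<psi> \<subseteq> {0, 7}" "set_bfm ?\<psi> \<subseteq> univ B"
    using fv const by (auto simp: bfv_formulas)
  note internal = internal_set_definable[OF Y l this, of e]
  have sat: "bsat H (e(0 := l, 7 := y, 3 := a, 4 := b, 5 := c)) (map_bfm (star E) \<phi>) \<longleftrightarrow>
      bsat H (e(0 := l, 3 := a, 4 := b, 5 := c)) (map_bfm (star E) \<phi>)" for y a b c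
    by (rule bsat_cong) (use fv in auto)
  have "bsat H (e(0 := l, 7 := y)) (map_bfm (star E) ?\<psi>) \<longleftrightarrow>
      (\<exists>a \<in> hnat E. \<exists>b \<in> hnat E. \<exists>c \<in> hnat E. y = otriple H a b c \<and> (a, b, c) \<in> ?R)"
    if "y \<in> members H (star E ?Y)" for y
  proof -
    have "y \<in> univ H" using that by (simp add: members_def)
    then show ?thesis by (simp add: hyp.bsat_tripF sat)
  qed
  moreover have "otriple H a b c \<in> members H (star E ?Y)"
    if "a \<in> hnat E" "b \<in> hnat E" "c \<in> hnat E" for a b c
    using that unfolding otriple_def star_prod_obj(2)[OF NP(1) NN(1)] by (auto simp: hyp.P)
  ultimately have "{y \<in> members H (star E ?Y). bsat H (e(0 := l, 7 := y)) (map_bfm (star E) ?\<psi>)} =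
      {otriple H a b c | a b c. (a, b, c) \<in> ?R}"
    by blast
  with internal show ?thesis unfolding internal_rel3_def by (simp only:)
qed


section \<open>The hyperfinite structure\<close>

lemma hzero_le: "x \<in> hnat E \<Longrightarrow> hle E (hstd E 0) x"
  using arith(1) by blast

lemma TH_eq: "TH E l = {i \<in> hnat E. hle E i l}"
  by (auto simp: TH_def hinterval_def hzero_le)

lemma one_eq: "hstd E 1 = hsuc (hstd E 0)" and two_eq: "hstd E 2 = hsuc (hstd E 1)"
  using hsuc_hstd[of 0] hsuc_hstd[of 1] by (simp_all add: numeral_2_eq_2)

lemma domain_eq:
  assumes "l \<in> hnat E"
  shows "TH E l \<union> agentH E l = {i \<in> hnat E. hle E i (hsuc l)}"
  using assms arith(2)[OF assms] hsuc_hnat[OF assms] by (auto simp: TH_eq agentH_def)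

text \<open>For l other than 0, the elements up to l - 1 are those up to l without l, so
  \<open>SH\<close> is the successor on [0, l] closed into a cycle at l. At l = 0 truncation would
  make the interval {0} and add a second triple.\<close>

lemma SH_iff:
  assumes "l \<in> hnat E" "l \<noteq> hstd E 0"
  shows "(z, x, y) \<in> SH E l \<longleftrightarrow>
    y = hsuc l \<and> x \<in> TH E l \<and> (if x = l then z = hstd E 0 else z = hsuc x)"
proof -
  have "hinterval E (hstd E 0) (hpred l) = {i \<in> hnat E. hle E i l \<and> i \<noteq> l}"
    using arith(6)[OF assms(1) _ assms(2)] by (auto simp: hinterval_def hzero_le)
  then show ?thesis
    using arith(11)[OF assms(1) assms(1)] assms(1) unfolding SH_def TH_eq by auto
qed

lemma hyperfinite_segment:
  assumes l: "l \<in> hnat E"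
  shows "hyperfinite E {i \<in> hnat E. hle E i (hsuc l)}" (is "hyperfinite E ?D")
proof -
  let ?n = "hsuc (hsuc l)"
  let ?I = "hinterval E (hstd E 1) ?n"
  have n: "?n \<in> hnat E" using l by (intro hsuc_hnat)
  have I: "?I = {i \<in> hnat E. i \<noteq> hstd E 0 \<and> hle E i ?n}"
    using arith(10) by (auto simp: hinterval_def simp del: One_nat_def)
  \<comment> \<open>Obtained from the opposite composition by cancelling the injective
    successor.\<close>
  have pred_suc: "hpred (hsuc j) = j" if "j \<in> hnat E" for j
  proof -
    note suc = hsuc_hnat[OF that]
    have "hsuc (hpred (hsuc j)) = hsuc j" by (rule arith(5)[OF suc suc arith(8)[OF that that]])
    then show ?thesis using arith(4)[OF hpred_hnat[OF suc] that] by blast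
  qed
  have "bij_betw hpred ?I ?D"
  proof (rule bij_betw_byWitness[where f' = hsuc])
    show "\<forall>i \<in> ?I. hsuc (hpred i) = i" unfolding I using arith(5) by blast
    show "\<forall>j \<in> ?D. hpred (hsuc j) = j" using pred_suc by blast
    show "hpred ` ?I \<subseteq> ?D"
    proof (intro image_subsetI)
      fix i assume "i \<in> ?I"
      then have i: "i \<in> hnat E" "i \<noteq> hstd E 0" "hle E i ?n" unfolding I by blast+
      then have "hle E (hsuc (hpred i)) ?n" using arith(5)[OF i(1) i(1) i(2)] by (simp only:)
      then show "hpred i \<in> ?D"
        using arith(9)[OF hpred_hnat[OF i(1)] hsuc_hnat[OF l]] hpred_hnat[OF i(1)] by blast
    qed
    show "hsuc ` ?D \<subseteq> ?I"
    proof (intro image_subsetI)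
      fix j assume "j \<in> ?D"
      then have j: "j \<in> hnat E" "hle E j (hsuc l)" by auto
      then show "hsuc j \<in> ?I"
        unfolding I using arith(8)[OF j(1) j(1)] arith(9)[OF j(1) hsuc_hnat[OF l]] hsuc_hnat[OF j(1)]
        by blast
    qed
  qed
  moreover have "internal_rel2 E {(i, hpred i) | i. i \<in> ?I}"
  proof -
    \<comment> \<open>Only l is a parameter, so variables 5 and 6 hold l + 1 and l + 2.\<close>
    let ?\<phi> = "BAnd (MI (Var 3) (num 1) (Var 4)) (BAnd (LE (num 1) (Var 3))
      (BEx 5 (Cst NN) (BEx 6 (Cst NN) (BAnd (PL (Var 0) (num 1) (Var 5))
        (BAnd (PL (Var 5) (num 1) (Var 6)) (LE (Var 3) (Var 6)))))))"
    have "bfv ?\<phi> \<subseteq> {0, 3, 4}" "set_bfm ?\<phi> \<subseteq> univ B"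
      by (auto simp: bfv_formulas)
    from internal_rel2_definable[OF l this, of undefined]
    have "internal_rel2 E {(a, b). a \<in> hnat E \<and> b \<in> hnat E \<and>
        b = hpred a \<and> hle E (hstd E 1) a \<and> hle E a ?n}"
      by (simp add: bsat_enl_LE bsat_enl_PL bsat_enl_MI star_natom l hsuc_hnat del: One_nat_def
          cong: conj_cong)
    also have "{(a, b). a \<in> hnat E \<and> b \<in> hnat E \<and> b = hpred a \<and> hle E (hstd E 1) a \<and> hle E a ?n} =
        {(i, hpred i) | i. i \<in> ?I}"
      using hpred_hnat by (auto simp: hinterval_def)
    finally show ?thesis .
  qed
  moreover have "hle E (hstd E 1) ?n"
    using arith(8)[OF hsuc_hnat[OF l] l] arith(10)[OF n l] by blast
  ultimately show ?thesis
    unfolding hyperfinite_def using n by blast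
qed

section \<open>Internality of the domain and the relations\<close>

lemma internal_TH: "l \<in> hnat E \<Longrightarrow> internal_set E (TH E l)"
  using internal_set_definable[OF NN(1), of l "LE (Var 7) (Var 0)" undefined]
  by (simp add: bfv_formulas bsat_enl_LE TH_eq cong: conj_cong)

lemma internal_agentH: "l \<in> hnat E \<Longrightarrow> internal_set E (agentH E l)"
proof -
  assume l: "l \<in> hnat E"
  have "internal_set E {y \<in> hnat E. y = hsuc l}"
    using internal_set_definable[OF NN(1) l, of "PL (Var 0) (num 1) (Var 7)" undefined] l
    by (simp add: bfv_formulas bsat_enl_PL star_natom del: One_nat_def cong: conj_cong)
  also have "{y \<in> hnat E. y = hsuc l} = agentH E l"
    using hsuc_hnat[OF l] by (auto simp: agentH_def)
  finally show ?thesis .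
qed

lemma internal_domain: "l \<in> hnat E \<Longrightarrow> internal_set E (TH E l \<union> agentH E l)"
proof -
  assume l: "l \<in> hnat E"
  have "internal_set E {y \<in> hnat E. hle E y l \<or> y = hsuc l}"
    using internal_set_definable[OF NN(1) l,
        of "BOr (LE (Var 7) (Var 0)) (PL (Var 0) (num 1) (Var 7))" undefined] l
    by (simp add: bfv_formulas bsat_enl_LE bsat_enl_PL star_natom del: One_nat_def cong: conj_cong)
  also have "{y \<in> hnat E. hle E y l \<or> y = hsuc l} = TH E l \<union> agentH E l"
    using hsuc_hnat[OF l] by (auto simp: agentH_def TH_eq)
  finally show ?thesis .
qed

lemma internal_NH: "internal_set E (NH E)"
proof -
  \<comment> \<open>The formula has no parameter; any standard number may serve as the value of
    variable 0.\<close>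
  have "internal_set E {y \<in> hnat E. y = hstd E 1 \<or> y = hstd E 2}"
    using internal_set_definable[OF NN(1) hstd_in_hnat,
        of "BOr (BEq (Var 7) (num 1)) (BEq (Var 7) (num 2))" undefined]
    by (simp add: star_natom del: One_nat_def)
  also have "{y \<in> hnat E. y = hstd E 1 \<or> y = hstd E 2} = NH E"
    by (auto simp: NH_def)
  finally show ?thesis .
qed

lemma internal_AH: "l \<in> hnat E \<Longrightarrow> internal_rel2 E (AH E l)"
proof -
  assume l: "l \<in> hnat E"
  let ?\<phi> = "BAnd (PL (Var 0) (num 1) (Var 3)) (LE (Var 4) (Var 0))"
  have "bfv ?\<phi> \<subseteq> {0, 3, 4}" "set_bfm ?\<phi> \<subseteq> univ B"
    by (auto simp: bfv_formulas)
  from internal_rel2_definable[OF l this, of undefined]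
  have "internal_rel2 E {(a, b). a \<in> hnat E \<and> b \<in> hnat E \<and> a = hsuc l \<and> hle E b l}"
    using l by (simp add: bsat_enl_LE bsat_enl_PL star_natom del: One_nat_def cong: conj_cong)
  also have "{(a, b). a \<in> hnat E \<and> b \<in> hnat E \<and> a = hsuc l \<and> hle E b l} = AH E l"
    using hsuc_hnat[OF l] by (auto simp: AH_def TH_def[symmetric] TH_eq)
  finally show ?thesis .
qed

lemma internal_DH: "l \<in> hnat E \<Longrightarrow> internal_rel2 E (DH E l)"
proof -
  assume l: "l \<in> hnat E"
  let ?\<phi> = "BOr (BAnd (BEq (Var 3) (num 1)) (BOr (BEq (Var 4) (num 0)) (PL (Var 0) (num 1) (Var 4))))
    (BAnd (BEq (Var 3) (num 2)) (BOr (BEq (Var 4) (num 1)) (PL (Var 0) (num 1) (Var 4))))"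
  have "bfv ?\<phi> \<subseteq> {0, 3, 4}" "set_bfm ?\<phi> \<subseteq> univ B"
    by (auto simp: bfv_formulas)
  from internal_rel2_definable[OF l this, of undefined]
  have "internal_rel2 E {(a, b). a \<in> hnat E \<and> b \<in> hnat E \<and>
      (a = hstd E 1 \<and> (b = hstd E 0 \<or> b = hsuc l) \<or> a = hstd E 2 \<and> (b = hstd E 1 \<or> b = hsuc l))}"
    using l by (simp add: bsat_enl_PL star_natom del: One_nat_def cong: conj_cong)
  also have "{(a, b). a \<in> hnat E \<and> b \<in> hnat E \<and>
      (a = hstd E 1 \<and> (b = hstd E 0 \<or> b = hsuc l) \<or> a = hstd E 2 \<and> (b = hstd E 1 \<or> b = hsuc l))} = DH E l"
    using hsuc_hnat[OF l] by (auto simp: DH_def)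
  finally show ?thesis .
qed

lemma internal_SH:
  assumes l: "l \<in> hnat E" and l0: "l \<noteq> hstd E 0"
  shows "internal_rel3 E (SH E l)"
proof -
  \<comment> \<open>This follows the cyclic description in \<open>SH_iff\<close>, which avoids the
    endpoint l - 1.\<close>
  let ?\<phi> = "BAnd (PL (Var 0) (num 1) (Var 5)) (BAnd (LE (Var 4) (Var 0))
    (BOr (BAnd (BEq (Var 4) (Var 0)) (BEq (Var 3) (num 0)))
      (BAnd (BNot (BEq (Var 4) (Var 0))) (PL (Var 4) (num 1) (Var 3)))))"
  have "bfv ?\<phi> \<subseteq> {0, 3, 4, 5}" "set_bfm ?\<phi> \<subseteq> univ B"
    by (auto simp: bfv_formulas)
  from internal_rel3_definable[OF l this, of undefined]
  have "internal_rel3 E {(a, b, c). a \<in> hnat E \<and> b \<in> hnat E \<and> c \<in> hnat E \<and> c = hsuc l \<and> hle E b l \<and>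
      (b = l \<and> a = hstd E 0 \<or> b \<noteq> l \<and> a = hsuc b)}"
    using l by (simp add: bsat_enl_LE bsat_enl_PL star_natom del: One_nat_def cong: conj_cong)
  also have "{(a, b, c). a \<in> hnat E \<and> b \<in> hnat E \<and> c \<in> hnat E \<and> c = hsuc l \<and> hle E b l \<and>
      (b = l \<and> a = hstd E 0 \<or> b \<noteq> l \<and> a = hsuc b)} = SH E l"
  proof -
    have "a \<in> hnat E \<and> b \<in> hnat E \<and> c \<in> hnat E \<and> c = hsuc l \<and> hle E b l \<and>
        (b = l \<and> a = hstd E 0 \<or> b \<noteq> l \<and> a = hsuc b) \<longleftrightarrow> (a, b, c) \<in> SH E l" for a b c
      unfolding SH_iff[OF l l0] TH_eq using hsuc_hnat[OF l] hsuc_hnat[of b] by auto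
    then show ?thesis by auto
  qed
  finally show ?thesis .
qed

section \<open>The axioms in the hyperfinite structure\<close>

lemma hstd_le_infinite:
  assumes "l \<in> hnat E - range (hstd E)"
  shows "hle E (hstd E p) l"
proof (induction p)
  case 0
  show ?case using assms hzero_le by blast
next
  \<comment> \<open>The induction runs over standard \<open>p\<close> only: from p \<le> l follows p
    = l or p + 1 \<le> l, and the former fails as l is not standard.\<close>
  case (Suc p)
  then show ?case
    using arith(7)[of "hstd E p" l] assms by (auto simp: hsuc_hstd simp del: One_nat_def)
qed

text \<open>\<open>SH\<close> is the graph of the cyclic successor on [0, l] with the agent l + 1 as
  constant last component. E3 is its functionality; R1 and one negation in R2 hold because the agent
  lies outside \<open>TH\<close>, the other negation because there is no two-cycle.\<close>

lemma tas_model_structH: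
  assumes l: "l \<in> hnat E - range (hstd E)"
  shows "tas_model (structH E l) TAS2"
proof -
  let ?S = "hsuc" and ?L = "hsuc l" and ?T = "TH E l"
  have lN: "l \<in> hnat E" and lstd: "l \<noteq> hstd E p" for p using l by auto
  have std: "hstd E p \<in> ?T" for p using hstd_le_infinite[OF l] by (simp add: TH_eq)
  have TN: "x \<in> hnat E" if "x \<in> ?T" for x using that by (simp add: TH_eq)
  have L: "?L \<notin> ?T" using arith(3)[OF lN lN] by (simp add: TH_eq)
  have lT: "l \<in> ?T" using arith(11)[OF lN lN] lN by (simp add: TH_eq)
  have ST: "?S x \<in> ?T" if "x \<in> ?T" "x \<noteq> l" for x
    using that arith(7)[of x l] lN hsuc_hnat[of x] by (auto simp: TH_eq)
  have S0: "?S x \<noteq> hstd E 0" if "x \<in> ?T" for x using arith(8) TN that by blast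
  have SS: "?S (?S x) \<noteq> x" if "x \<in> ?T" for x
  proof -
    have "hle E (?S x) (?S (?S x))"
      using arith(2)[of "?S x" "?S x"] arith(11)[of "?S x" "?S x"] hsuc_hnat[OF TN[OF that]] by blast
    moreover have "\<not> hle E (?S x) x" using TN[OF that] by (intro arith(3))
    ultimately show ?thesis by auto
  qed
  have SH: "(z, x, y) \<in> SH E l \<longleftrightarrow>
      y = ?L \<and> x \<in> ?T \<and> (if x = l then z = hstd E 0 else z = ?S x)" for x y z
    by (rule SH_iff[OF lN lstd])
  have AH: "(y, x) \<in> AH E l \<longleftrightarrow> y = ?L \<and> x \<in> ?T" for x y
    by (auto simp: AH_def TH_def)
  have dom: "domain (structH E l) = insert ?L ?T" by (auto simp: structH_def agentH_def)
  have rels: "relT (structH E l) = ?T" "relA (structH E l) = AH E l" "relS (structH E l) = SH E l"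
    "relD (structH E l) = DH E l" "relN (structH E l) = NH E" by (simp_all add: structH_def)
  have SH_T: "z \<in> ?T" if "(z, x, y) \<in> SH E l" for x y z
    using that ST std by (auto simp: SH split: if_splits)
  have struct: "tas_structure (structH E l)"
  proof -
    have "SH E l \<subseteq> ?T \<times> ?T \<times> {?L}"
    proof (intro subrelI)
      fix z p assume "(z, p) \<in> SH E l"
      moreover obtain x y where "p = (x, y)" by (cases p)
      ultimately have "(z, x, y) \<in> SH E l" "p = (x, y)" by simp_all
      then show "(z, p) \<in> ?T \<times> ?T \<times> {?L}" using SH_T SH by blast
    qed
    moreover have "AH E l \<subseteq> {?L} \<times> ?T" by (intro subrelI) (simp add: AH)
    moreover have "DH E l \<subseteq> ?T \<times> insert ?L ?T"
      using std[of 0] std[of 1] std[of 2] unfolding DH_def by blast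
    moreover have "NH E \<subseteq> ?T"
      using std[of 1] std[of 2] unfolding NH_def by blast
    ultimately show ?thesis
      unfolding tas_structure_def dom rels by blast
  qed
  have one: "?S (hstd E 0) = hstd E 1" and two: "?S (hstd E 1) = hstd E 2"
    by (rule one_eq[symmetric] two_eq[symmetric])+
  \<comment> \<open>The triples for 0 and 1 are the ones whose head \<open>DH\<close> relates to
    both other components, which places 1 and 2 in the defined N.\<close>
  have "(?S x, x, ?L) \<in> SH E l" if "x \<in> ?T" "x \<noteq> l" for x using that by (simp add: SH)
  from this[OF std lstd[symmetric], of 0] this[OF std lstd[symmetric], of 1]
  have S1: "(hstd E 1, hstd E 0, ?L) \<in> SH E l" "(hstd E 2, hstd E 1, ?L) \<in> SH E l"
    unfolding one two .
  note simps = dom rels AH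
  have E1: "fsat (structH E l) e ax_E1" for e
    using std by (auto simp: ax_E1_def simps)
  have E2: "fsat (structH E l) e ax_E2" for e
    by (auto simp: ax_E2_def simps)
  have E3: "fsat (structH E l) e ax_E3" for e
  proof -
    have "\<exists>!z. z \<in> insert ?L ?T \<and> (z, x, ?L) \<in> SH E l" if "x \<in> ?T" for x
      using that ST std by (cases "x = l") (auto simp: SH)
    then show ?thesis by (auto simp: ax_E3_def simps)
  qed
  have R1: "fsat (structH E l) e ax_R1" for e
    using L by (auto simp: ax_R1_def simps)
  have R2: "fsat (structH E l) e ax_R2" for e
  proof -
    have *: "z \<in> ?T \<and> x \<in> ?T \<and> y = ?L \<and> (x, z, y) \<notin> SH E l \<and> (y, x, z) \<notin> SH E l"
      if h: "(z, x, y) \<in> SH E l" for x y z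
    proof -
      have z: "z \<in> ?T" using h by (rule SH_T)
      have xy: "x \<in> ?T" "y = ?L" using h by (auto simp: SH)
      \<comment> \<open>A last component is always the agent, whereas \<open>z\<close> lies in
        \<open>TH\<close>.\<close>
      have "(y, x, z) \<notin> SH E l" using z L by (auto simp: SH)
      moreover have "(x, z, y) \<notin> SH E l"
      proof
        assume "(x, z, y) \<in> SH E l"
        then have 1: "if z = l then x = hstd E 0 else x = ?S z" by (simp add: SH)
        have 2: "if x = l then z = hstd E 0 else z = ?S x" using h by (simp add: SH)
        \<comment> \<open>Both triples would give a two-cycle. If it passes through the wrap-around
          at l, the cycle is {0, 1} and l = 1, which is standard; otherwise \<open>SS\<close>
          excludes it.\<close>
        show False
        proof (cases "z = l")
          case True
          then have "x = hstd E 0" using 1 by simp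
          then have "l = hstd E 1" using 2 True lstd[of 0] one by auto
          then show False using lstd by blast
        next
          case z: False
          show False
          proof (cases "x = l")
            case True
            then have "z = hstd E 0" using 2 by simp
            then have "l = hstd E 1" using 1 True z one by auto
            then show False using lstd by blast
          next
            case False
            have "x = ?S z" using 1 unfolding if_not_P[OF z] .
            also have "z = ?S x" using 2 unfolding if_not_P[OF False] .
            finally show False using SS[OF xy(1), symmetric] by (rule notE[rotated])
          qed
        qed
      qed
      ultimately show ?thesis using z xy by blast
    qed
    show ?thesis by (simp add: ax_R2_def rels AH, intro ballI impI, drule *, simp)
  qed
  have E4: "fsat (structH E l) e ax_E4" for e
    using std by (auto simp: ax_E4_def simps NH_def)
  have E5: "fsat (structH E l) e ax_E5" for e
    using std by (auto simp: ax_E5_def simps NH_def)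
  have N: "fsat (structH E l) e def_N" for e
  proof -
    have "z \<in> NH E \<longleftrightarrow> (\<exists>x \<in> insert ?L ?T. \<exists>y \<in> insert ?L ?T.
        (z, x, y) \<in> SH E l \<and> (z, x) \<in> DH E l \<and> (z, y) \<in> DH E l)" for z
    proof
      assume "z \<in> NH E"
      then consider "z = hstd E 1" | "z = hstd E 2" by (auto simp: NH_def)
      then show "\<exists>x \<in> insert ?L ?T. \<exists>y \<in> insert ?L ?T.
          (z, x, y) \<in> SH E l \<and> (z, x) \<in> DH E l \<and> (z, y) \<in> DH E l"
      proof cases
        case 1
        then show ?thesis using S1(1) std unfolding DH_def by blast
      next
        case 2
        then show ?thesis using S1(2) std unfolding DH_def by blast
      qed
    \<comment> \<open>The converse is immediate, as 1 and 2 are the only first components in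
      \<open>DH\<close>.\<close>
    qed (auto simp: DH_def NH_def)
    then show ?thesis unfolding dom[symmetric] by (simp add: def_N_def rels)
  qed
  show ?thesis
    by (simp add: tas_model_def TAS2_def TAS1_def struct E1 E2 E3 R1 R2 E4 E5 N)
qed

end

theorem theorem3p1:
  fixes E :: "('a, 'b) nsm" and l :: 'b
  assumes "nonstandard_model E"
    and "l \<in> hnat E - range (hstd E)"
  shows "hyperfinite E (domain (structH E l)) \<and> infinite (domain (structH E l)) \<and>
    internal_set E (TH E l \<union> agentH E l) \<and>
    internal_set E (TH E l) \<and>
    internal_set E (agentH E l) \<and>
    internal_set E (NH E) \<and>
    internal_rel3 E (SH E l) \<and>
    internal_rel2 E (AH E l) \<and>
    internal_rel2 E (DH E l) \<and>
    tas_model (structH E l) TAS1 \<and>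
    tas_model (structH E l) TAS2"
proof -
  interpret nonstandard E by unfold_locales (rule assms(1))
  have l: "l \<in> hnat E" and l0: "l \<noteq> hstd E 0" using assms(2) by auto
  have dom: "domain (structH E l) = TH E l \<union> agentH E l" by (simp add: structH_def)
  \<comment> \<open>Infinity is meant externally: the domain contains a copy of all standard
    numbers, although an internal bijection counts it.\<close>
  have "range (hstd E) \<subseteq> TH E l"
    using hstd_le_infinite[OF assms(2)] by (auto simp: TH_eq)
  moreover have "infinite (range (hstd E))"
    by (subst finite_image_iff) (auto simp: inj_on_def)
  ultimately have "infinite (domain (structH E l))"
    unfolding dom using finite_subset by blast
  moreover have "hyperfinite E (domain (structH E l))"
    unfolding dom domain_eq[OF l] by (rule hyperfinite_segment[OF l])
  moreover have "tas_model (structH E l) TAS1"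
    using tas_model_structH[OF assms(2)] by (auto simp: tas_model_def TAS2_def)
  ultimately show ?thesis
    using internal_domain[OF l] internal_TH[OF l] internal_agentH[OF l] internal_NH
      internal_SH[OF l l0] internal_AH[OF l] internal_DH[OF l] tas_model_structH[OF assms(2)]
    by blast
qed

end
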